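(* Let $\mathbb{F}$ be an algebraically closed field, let $G(\lambda)\in\mathbb{F}(\lambda)^{p\times m}$, and let $$\mathcal{L}(\lambda)=\begin{bmatrix}A_1\lambda+A_0&B_1\lambda+B_0\\-(C_1\lambda+C_0)&D_1\lambda+D_0\end{bmatrix}\in\mathbb{F}[\lambda]^{(n+q)\times(n+r)}$$ (with $n\times n$ state matrix $A_1\lambda+A_0$) be an ADMZ-strong linearization of $G(\lambda)$. Write $G(\lambda)=Q(\lambda)+G_{sp}(\lambda)$ uniquely with $Q(\lambda)$ a polynomial matrix and $G_{sp}(\lambda)$ strictly proper, and let $g_G:=\deg(Q(\lambda))$ if $G(\lambda)$ is not strictly proper and $g_G:=0$ otherwise. Then: (a) If $n=0$, or if $n>0$ and $D_1+C_1A_1^{-1}B_1\neq0$, then $\mathcal{L}(\lambda)$ is a $g_G$-strong linearization of $G(\lambda)$. (b) If $n>0$, $D_1+C_1A_1^{-1}B_1=0$, $q=p$ and $r=m$, then $\mathcal{L}(\lambda)$ is a $(g_G+1)$-strong linearization of $G(\lambda)$. (c) If $n>0$, $D_1+C_1A_1^{-1}B_1=0$, and $q\neq p$ or $r\neq m$, then $\mathcal{L}(\lambda)$ is not a $g$-strong linearization of $G(\lambda)$ for any integer $g$.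
   Context: For a rational matrix $G(\lambda)$ and an integer $g$, $\operatorname{rev}_gG(\lambda):=\lambda^gG(1/\lambda)$. A rational function is strictly proper if its numerator has smaller degree than its denominator; a matrix is strictly proper if all its entries are. If $G=Q+G_{sp}$ is the unique decomposition into polynomial and strictly proper parts, then $\operatorname{rev}G(\lambda):=\operatorname{rev}_gG(\lambda)$ with $g=\deg Q$ if $G$ is not strictly proper and $g=0$ if $G$ is strictly proper (the degree of a polynomial matrix is the largest exponent with nonzero coefficient; for a polynomial matrix, including zero with $g=0$, this gives its usual reversal). A square rational matrix is regular at $\lambda_0\in\mathbb{F}$ if none of its entries has a pole at $\lambda_0$ and its determinant is nonzero at $\lambda_0$. A polynomial system matrix is a partitioned polynomial matrix $\begin{bmatrix}A&B\\-C&D\end{bmatrix}$ with $A(\lambda)$ of size $n\times n$ and $\det A(\lambda)\not\equiv0$ (if $n>0$); $A$ is its state matrix and $D+CA^{-1}B$ its transfer function matrix; if $n=0$ the blocks $A,B,C$ are empty. It is linear if all blocks have degree at most $1$. For $n>0$ it is minimal at $\lambda_0$ if $\operatorname{rank}\begin{bmatrix}A(\lambda_0)\\C(\lambda_0)\end{bmatrix}=\operatorname{rank}\begin{bmatrix}A(\lambda_0)&B(\lambda_0)\end{bmatrix}=n$; for $n=0$ it is by convention minimal at every point of $\mathbb{F}$. The reversal of a linear polynomial system matrix, with the same partition, is again a linear polynomial system matrix. Let $\mathcal{L}(\lambda)\in\mathbb{F}[\lambda]^{(n+q)\times(n+r)}$ be a linear polynomial system matrix with transfer function matrix $\widehat G(\lambda)\in\mathbb{F}(\lambda)^{q\times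 r}$ and $\ell=\deg\mathcal{L}(\lambda)$. - $\mathcal{L}$ is a linearization of $G(\lambda)\in\mathbb{F}(\lambda)^{p\times m}$ at $\lambda_0\in\mathbb{F}$ if $\mathcal{L}$ is minimal at $\lambda_0$ and there exist integers $s_1,s_2\ge0$ with $s_1-s_2=q-p=r-m$ and rational matrices $R_1,R_2$ regular at $\lambda_0$, of sizes $p+s_1$ and $m+s_1$, with $R_1\,\mathrm{diag}(G,I_{s_1})\,R_2=\mathrm{diag}(\widehat G,I_{s_2})$. It is a linearization in $\mathbb{F}$ if it is so at every $\lambda_0\in\mathbb{F}$. - $\mathcal{L}$ is a linearization of $G$ at $\infty$ of grade $g$ if $\operatorname{rev}\mathcal{L}$ is minimal at $0$ and there exist integers $s_1,s_2\ge0$ with $s_1-s_2=q-p=r-m$ and rational matrices $Q_1,Q_2$ regular at $0$, of sizes $p+s_1$ and $m+s_1$, with $Q_1\,\mathrm{diag}(\operatorname{rev}_gG,I_{s_1})\,Q_2=\mathrm{diag}(\operatorname{rev}_\ell\widehat G,I_{s_2})$. - $\mathcal{L}$ is a $g$-strong linearization of $G$ ($g$ an integer) if it is a linearization of $G$ in $\mathbb{F}$ and also at $\infty$ of grade $g$. - $\mathcal{L}$ is an ADMZ-strong linearization of $G$ (a strong linearization in the sense of an earlier definition from the literature) if: $\mathcal{L}$ is a linearization of $G$ in $\mathbb{F}$; $A_1$ is invertible if $n>0$; and there exist integers $s_1,s_2\ge0$ and rational matrices $Q_1\in\mathbb{F}(\lambda)^{(p+s_1)\times(p+s_1)}$, $Q_2\in\mathbb{F}(\lambda)^{(m+s_1)\times(m+s_1)}$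 regular at $0$ with $Q_1\,\mathrm{diag}(\operatorname{rev}G,I_{s_1})\,Q_2=\mathrm{diag}(\operatorname{rev}\widehat G,I_{s_2})$. *)

theory Defs
  imports "Jordan_Normal_Form.DL_Rank" "Jordan_Normal_Form.Gauss_Jordan_Elimination"
begin

text \<open>Rational functions over a field \<open>'a\<close> are elements of \<open>'a poly fract\<close>, and matrices are those of
  the library theory \<^theory>\<open>Jordan_Normal_Form.Matrix\<close>, whose dimensions are natural numbers,
  possibly \<open>0\<close>.\<close>

section \<open>Rational functions\<close>

definition has_pole :: "'a::field poly fract \<Rightarrow> 'a \<Rightarrow> bool" where
  "has_pole f x \<longleftrightarrow> (\<exists>a b. b \<noteq> 0 \<and> coprime a b \<and> f = Fract a b \<and> poly b x = 0)"

text \<open>The value of a rational function at a point. It is meaningful only where there is no pole;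
  see \<open>rat_eval_Fract\<close> below for its independence of the chosen representation.\<close>

definition rat_eval :: "'a::field poly fract \<Rightarrow> 'a \<Rightarrow> 'a" where
  "rat_eval f x = (case (SOME (a, b). poly b x \<noteq> 0 \<and> f = Fract a b) of
     (a, b) \<Rightarrow> poly a x / poly b x)"

definition strictly_proper :: "'a::field poly fract \<Rightarrow> bool" where
  "strictly_proper f \<longleftrightarrow> (\<exists>a b. b \<noteq> 0 \<and> f = Fract a b \<and> (a = 0 \<or> degree a < degree b))"

definition rat_var :: "'a::field poly fract" where
  "rat_var = to_fract [:0, 1:]"

definition poly_at_rat :: "'a::field poly \<Rightarrow> 'a poly fract \<Rightarrow> 'a poly fract" where
  "poly_at_rat p h = (\<Sum>i\<le>degree p. to_fract [:coeff p i:] * h ^ i)"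

text \<open>The substitution of \<open>1/\<lambda>\<close> for \<open>\<lambda>\<close> in a rational function; see \<open>rat_recip_Fract\<close> below for its
  independence of the chosen representation.\<close>

definition rat_recip :: "'a::field poly fract \<Rightarrow> 'a poly fract" where
  "rat_recip f = (case (SOME (a, b). b \<noteq> 0 \<and> f = Fract a b) of
     (a, b) \<Rightarrow> poly_at_rat a (1 / rat_var) / poly_at_rat b (1 / rat_var))"

definition rat_rev :: "int \<Rightarrow> 'a::field poly fract \<Rightarrow> 'a poly fract" where
  "rat_rev g f = (rat_var powi g) * rat_recip f"

section \<open>Rational and polynomial matrices\<close>

definition strictly_proper_mat :: "'a::field poly fract mat \<Rightarrow> bool" where
  "strictly_proper_mat M \<longleftrightarrow> (\<forall>i<dim_row M. \<forall>j<dim_col M. strictly_proper (M $$ (i, j)))"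

definition regular_at :: "'a::field poly fract mat \<Rightarrow> 'a \<Rightarrow> bool" where
  "regular_at M x \<longleftrightarrow> square_mat M \<and>
     (\<forall>i<dim_row M. \<forall>j<dim_col M. \<not> has_pole (M $$ (i, j)) x) \<and> rat_eval (det M) x \<noteq> 0"

text \<open>The degree of a zero (or empty) polynomial matrix is \<open>0\<close> here, which is the value
  of the grade used for the reversal of a zero matrix.\<close>

definition mat_degree :: "'a::zero poly mat \<Rightarrow> nat" where
  "mat_degree M = Max (insert 0 (degree ` elements_mat M))"

definition polynomial_part :: "'a::field poly fract mat \<Rightarrow> 'a poly mat" where
  "polynomial_part G = (THE Q. Q \<in> carrier_mat (dim_row G) (dim_col G) \<and>
     (\<exists>Gsp \<in> carrier_mat (dim_row G) (dim_col G).
        strictly_proper_mat Gsp \<and> G = map_mat to_fract Q + Gsp))"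

definition natural_grade :: "'a::field poly fract mat \<Rightarrow> nat" where
  "natural_grade G = (if strictly_proper_mat G then 0 else mat_degree (polynomial_part G))"

abbreviation rev_grade :: "int \<Rightarrow> 'a::field poly fract mat \<Rightarrow> 'a poly fract mat" where
  "rev_grade g G \<equiv> map_mat (rat_rev g) G"

definition rat_mat_rev :: "'a::field poly fract mat \<Rightarrow> 'a poly fract mat" where
  "rat_mat_rev G = rev_grade (int (natural_grade G)) G"

text \<open>\<open>\<lambda>\<^sup>g p(1/\<lambda>)\<close> as a polynomial, for \<open>degree p \<le> g\<close>; see \<open>rat_rev_to_fract\<close> below.\<close>

definition poly_rev :: "nat \<Rightarrow> 'a::field poly \<Rightarrow> 'a poly" where
  "poly_rev g p = (\<Sum>i\<le>g. monom (coeff p (g - i)) i)"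

text \<open>\<open>pencil M1 M0\<close> is \<open>M1 \<lambda> + M0\<close>.\<close>

definition pencil :: "'a::field mat \<Rightarrow> 'a mat \<Rightarrow> 'a poly mat" where
  "pencil M1 M0 = [:0, 1:] \<cdot>\<^sub>m map_mat (\<lambda>c. [:c:]) M1 + map_mat (\<lambda>c. [:c:]) M0"

section \<open>Polynomial system matrices\<close>

text \<open>\<open>PSM A B C D\<close> is the partitioned matrix with blocks \<open>A\<close>, \<open>B\<close>, \<open>-C\<close>, \<open>D\<close>;
  note the sign of \<open>C\<close>.\<close>

datatype 'e partitioned_mat =
  PSM (psm_A: "'e mat") (psm_B: "'e mat") (psm_C: "'e mat") (psm_D: "'e mat")

type_synonym 'a psm = "'a poly partitioned_mat"

definition psm_mat :: "'a::field psm \<Rightarrow> 'a poly mat" where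
  "psm_mat L = four_block_mat (psm_A L) (psm_B L) (- psm_C L) (psm_D L)"

abbreviation state_dim :: "'a::field psm \<Rightarrow> nat" where
  "state_dim L \<equiv> dim_row (psm_A L)"

abbreviation psm_degree :: "'a::field psm \<Rightarrow> nat" where
  "psm_degree L \<equiv> mat_degree (psm_mat L)"

definition polynomial_system_matrix :: "'a::field psm \<Rightarrow> bool" where
  "polynomial_system_matrix L \<longleftrightarrow>
     (let n = state_dim L; q = dim_row (psm_D L); r = dim_col (psm_D L) in
        psm_A L \<in> carrier_mat n n \<and> psm_B L \<in> carrier_mat n r \<and>
        psm_C L \<in> carrier_mat q n \<and> psm_D L \<in> carrier_mat q r \<and>
        (n > 0 \<longrightarrow> det (psm_A L) \<noteq> 0))"

definition linear_psm :: "'a::field psm \<Rightarrow> bool" where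
  "linear_psm L \<longleftrightarrow> polynomial_system_matrix L \<and>
     mat_degree (psm_A L) \<le> 1 \<and> mat_degree (psm_B L) \<le> 1 \<and>
     mat_degree (psm_C L) \<le> 1 \<and> mat_degree (psm_D L) \<le> 1"

definition transfer_function :: "'a::field psm \<Rightarrow> 'a poly fract mat" where
  "transfer_function L =
     map_mat to_fract (psm_D L) +
     map_mat to_fract (psm_C L) * the (mat_inverse (map_mat to_fract (psm_A L))) *
       map_mat to_fract (psm_B L)"

definition mat_rank :: "'a::field mat \<Rightarrow> nat" where
  "mat_rank M = vec_space.rank (dim_row M) M"

abbreviation eval_mat :: "'a::field poly mat \<Rightarrow> 'a \<Rightarrow> 'a mat" where
  "eval_mat M x \<equiv> map_mat (\<lambda>p. poly p x) M"

definition append_cols_mat :: "'a::zero mat \<Rightarrow> 'a mat \<Rightarrow> 'a mat" where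
  "append_cols_mat M N = four_block_mat M N (0\<^sub>m 0 (dim_col M)) (0\<^sub>m 0 (dim_col N))"

definition minimal_at :: "'a::field psm \<Rightarrow> 'a \<Rightarrow> bool" where
  "minimal_at L x \<longleftrightarrow> (state_dim L > 0 \<longrightarrow>
     mat_rank (eval_mat (psm_A L) x @\<^sub>r eval_mat (psm_C L) x) = state_dim L \<and>
     mat_rank (append_cols_mat (eval_mat (psm_A L) x) (eval_mat (psm_B L) x)) = state_dim L)"

text \<open>All blocks are reversed with respect to the degree of the whole system matrix.\<close>

definition psm_rev :: "'a::field psm \<Rightarrow> 'a psm" where
  "psm_rev L = (let R = map_mat (poly_rev (psm_degree L)) in
     PSM (R (psm_A L)) (R (psm_B L)) (R (psm_C L)) (R (psm_D L)))"

section \<open>Linearizations\<close>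

definition padded_equivalent_at ::
  "'a::field \<Rightarrow> nat \<Rightarrow> nat \<Rightarrow> 'a poly fract mat \<Rightarrow> 'a poly fract mat \<Rightarrow> bool" where
  "padded_equivalent_at x s1 s2 G H \<longleftrightarrow>
     (\<exists>R1 \<in> carrier_mat (dim_row G + s1) (dim_row G + s1).
      \<exists>R2 \<in> carrier_mat (dim_col G + s1) (dim_col G + s1).
        regular_at R1 x \<and> regular_at R2 x \<and>
        R1 * diag_block_mat [G, 1\<^sub>m s1] * R2 = diag_block_mat [H, 1\<^sub>m s2])"

definition compatible_padding ::
  "nat \<Rightarrow> nat \<Rightarrow> 'a::field poly fract mat \<Rightarrow> 'a poly fract mat \<Rightarrow> bool" where
  "compatible_padding s1 s2 G H \<longleftrightarrow>
     int s1 - int s2 = int (dim_row H) - int (dim_row G) \<and>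
     int (dim_row H) - int (dim_row G) = int (dim_col H) - int (dim_col G)"

definition linearization_at :: "'a::field psm \<Rightarrow> 'a poly fract mat \<Rightarrow> 'a \<Rightarrow> bool" where
  "linearization_at L G x \<longleftrightarrow> linear_psm L \<and> minimal_at L x \<and>
     (\<exists>s1 s2. compatible_padding s1 s2 G (transfer_function L) \<and>
        padded_equivalent_at x s1 s2 G (transfer_function L))"

definition finite_linearization :: "'a::field psm \<Rightarrow> 'a poly fract mat \<Rightarrow> bool" where
  "finite_linearization L G \<longleftrightarrow> (\<forall>x. linearization_at L G x)"

definition linearization_at_infinity ::
  "int \<Rightarrow> 'a::field psm \<Rightarrow> 'a poly fract mat \<Rightarrow> bool" where
  "linearization_at_infinity g L G \<longleftrightarrow> linear_psm L \<and> minimal_at (psm_rev L) 0 \<and>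
     (\<exists>s1 s2. compatible_padding s1 s2 G (transfer_function L) \<and>
        padded_equivalent_at 0 s1 s2 (rev_grade g G)
          (rev_grade (int (psm_degree L)) (transfer_function L)))"

definition strong_linearization :: "int \<Rightarrow> 'a::field psm \<Rightarrow> 'a poly fract mat \<Rightarrow> bool" where
  "strong_linearization g L G \<longleftrightarrow> finite_linearization L G \<and> linearization_at_infinity g L G"

text \<open>The coefficient of \<open>\<lambda>\<close> in the state matrix is \<open>map_mat (\<lambda>p. coeff p 1) (psm_A L)\<close>. Each of
  the two reversals uses the natural grade of its own argument, and no relation between
  \<open>s1\<close>, \<open>s2\<close> and the sizes is imposed beyond the one implied by the matrix identity.\<close>

definition ADMZ_strong_linearization :: "'a::field psm \<Rightarrow> 'a poly fract mat \<Rightarrow> bool" where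
  "ADMZ_strong_linearization L G \<longleftrightarrow> finite_linearization L G \<and>
     (state_dim L > 0 \<longrightarrow> invertible_mat (map_mat (\<lambda>p. coeff p 1) (psm_A L))) \<and>
     (\<exists>s1 s2. padded_equivalent_at 0 s1 s2 (rat_mat_rev G) (rat_mat_rev (transfer_function L)))"

section \<open>Well-definedness of the choices made above\<close>

lemma lowest_terms_exist:
  fixes b :: "'a::field poly"
  assumes "b \<noteq> 0"
  shows "\<exists>c d. d \<noteq> 0 \<and> coprime c d \<and> Fract a b = Fract c d"
  using assms
proof (induction "degree b" arbitrary: a b rule: less_induct)
  case less
  show ?case
  proof (cases "coprime a b")
    case True
    then show ?thesis using less.prems by blast
  next
    case False
    then obtain e where e: "e dvd a" "e dvd b" "\<not> is_unit e"
      by (meson not_coprimeE)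
    obtain a' b' where ab: "a = e * a'" "b = e * b'" using e by (auto elim!: dvdE)
    have nz: "e \<noteq> 0" "b' \<noteq> 0" using less.prems ab by auto
    have "degree e \<noteq> 0" using e(3) nz(1) by (metis is_unit_iff_degree)
    hence "degree b' < degree b" using nz ab(2) by (simp add: degree_mult_eq)
    moreover have "Fract a b = Fract a' b'" using nz ab by (simp add: eq_fract)
    ultimately show ?thesis using less.hyps[of b' a'] nz(2) by simp
  qed
qed

lemma not_has_pole_iff: "\<not> has_pole f x \<longleftrightarrow> (\<exists>a b. poly b x \<noteq> 0 \<and> f = Fract a b)"
proof
  assume np: "\<not> has_pole f x"
  obtain a b where "f = Fract a b" "b \<noteq> 0" by (cases f) auto
  then obtain c d where "d \<noteq> 0" "coprime c d" "f = Fract c d"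
    using lowest_terms_exist by metis
  with np show "\<exists>a b. poly b x \<noteq> 0 \<and> f = Fract a b"
    unfolding has_pole_def by blast
next
  assume "\<exists>a b. poly b x \<noteq> 0 \<and> f = Fract a b"
  then obtain a b where ab: "poly b x \<noteq> 0" "f = Fract a b" by blast
  show "\<not> has_pole f x"
  proof
    assume "has_pole f x"
    then obtain c d where cd: "d \<noteq> 0" "coprime c d" "f = Fract c d" "poly d x = 0"
      unfolding has_pole_def by blast
    have "b \<noteq> 0" using ab by auto
    hence "a * d = c * b" using ab cd by (simp add: eq_fract)
    hence "poly c x * poly b x = 0" using cd(4) by (metis mult_zero_right poly_mult)
    hence "poly c x = 0" using ab(1) by simp
    hence "[:-x, 1:] dvd c" "[:-x, 1:] dvd d" using cd(4) by (simp_all add: poly_eq_0_iff_dvd)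
    hence "is_unit [:-x, 1:]" using cd(2) by (meson coprime_common_divisor)
    thus False by (simp add: is_unit_iff_degree)
  qed
qed

lemma rat_eval_Fract:
  assumes "poly b x \<noteq> 0"
  shows "rat_eval (Fract a b) x = poly a x / poly b x"
proof -
  let ?P = "\<lambda>(c, d). poly d x \<noteq> 0 \<and> Fract a b = Fract c d"
  obtain c d where cd: "(SOME z. ?P z) = (c, d)" by (cases "SOME z. ?P z")
  have "?P (SOME z. ?P z)" by (rule someI[of ?P "(a, b)"]) (use assms in auto)
  hence d: "poly d x \<noteq> 0" "Fract a b = Fract c d" unfolding cd by auto
  have "b \<noteq> 0" "d \<noteq> 0" using assms d by auto
  hence "a * d = c * b" using d by (simp add: eq_fract)
  hence "poly a x * poly d x = poly c x * poly b x" by (metis poly_mult)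
  thus ?thesis unfolding rat_eval_def cd using assms d by (simp add: field_simps)
qed

lemma rat_var_nonzero [simp]: "rat_var \<noteq> 0"
  by (simp add: rat_var_def)

lemma to_fract_power: "to_fract (p ^ k) = to_fract p ^ k"
  by (induction k) simp_all

lemma to_fract_sum: "to_fract (sum f S) = (\<Sum>i\<in>S. to_fract (f i))"
  by (induction S rule: infinite_finite_induct) simp_all

lemma to_fract_monom: "to_fract (monom c k) = to_fract [:c:] * rat_var ^ k"
  by (simp add: monom_altdef rat_var_def flip: to_fract_power to_fract_mult)

lemma rat_var_power_poly_at_recip:
  assumes "degree p \<le> g"
  shows "rat_var ^ g * poly_at_rat p (1 / rat_var) = to_fract (poly_rev g p)"
proof -
  have "rat_var ^ g * poly_at_rat p (1 / rat_var) =
          (\<Sum>i\<le>degree p. to_fract [:coeff p i:] * rat_var ^ (g - i))"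
    unfolding poly_at_rat_def sum_distrib_left
    by (rule sum.cong) (use assms in \<open>auto simp: power_diff field_simps\<close>)
  also have "\<dots> = (\<Sum>i\<le>g. to_fract [:coeff p i:] * rat_var ^ (g - i))"
    by (rule sum.mono_neutral_left) (use assms in \<open>auto simp: coeff_eq_0\<close>)
  also have "\<dots> = (\<Sum>i\<le>g. to_fract [:coeff p (g - i):] * rat_var ^ i)"
    by (rule sum.reindex_bij_witness[of _ "\<lambda>i. g - i" "\<lambda>i. g - i"]) auto
  finally show ?thesis by (simp add: poly_rev_def to_fract_sum to_fract_monom)
qed

lemma poly_rev_degree: "poly_rev (degree p) p = reflect_poly p"
  by (rule poly_eqI) (auto simp: poly_rev_def coeff_sum coeff_reflect_poly)

lemma poly_at_recip:
  "poly_at_rat p (1 / rat_var) = to_fract (reflect_poly p) / rat_var ^ degree p"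
  using rat_var_power_poly_at_recip[of p "degree p"]
  by (simp add: poly_rev_degree field_simps)

lemma rat_recip_Fract:
  assumes "b \<noteq> 0"
  shows "rat_recip (Fract a b) = poly_at_rat a (1 / rat_var) / poly_at_rat b (1 / rat_var)"
proof -
  let ?P = "\<lambda>(c, d). d \<noteq> 0 \<and> Fract a b = Fract c d"
  obtain c d where cd: "(SOME z. ?P z) = (c, d)" by (cases "SOME z. ?P z")
  have "?P (SOME z. ?P z)" by (rule someI[of ?P "(a, b)"]) (use assms in auto)
  hence d: "d \<noteq> 0" "Fract a b = Fract c d" unfolding cd by auto
  have eq: "a * d = c * b" using assms d by (simp add: eq_fract)
  let ?E = "\<lambda>p. poly_at_rat p (1 / rat_var)"
  have mult: "?E (p * q) = ?E p * ?E q" for p q :: "'a poly"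
    by (cases "p = 0 \<or> q = 0")
      (auto simp: poly_at_recip reflect_poly_mult degree_mult_eq power_add)
  have nz: "?E p \<noteq> 0" if "p \<noteq> 0" for p :: "'a poly"
    using that by (simp add: poly_at_recip)
  have "?E a * ?E d = ?E c * ?E b" using mult eq by metis
  thus ?thesis unfolding rat_recip_def cd using nz[OF assms] nz[OF d(1)]
    by (simp add: field_simps)
qed

lemma rat_rev_to_fract:
  assumes "degree p \<le> g"
  shows "rat_rev (int g) (to_fract p) = to_fract (poly_rev g p)"
proof -
  have "poly_at_rat 1 (1 / rat_var) = (1 :: 'a poly fract)"
    by (simp add: poly_at_recip)
  thus ?thesis
    using rat_recip_Fract[of 1 p] rat_var_power_poly_at_recip[OF assms]
    by (simp add: rat_rev_def to_fract_def)
qed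

lemma strictly_proper_diff:
  assumes "strictly_proper f" "strictly_proper h"
  shows "strictly_proper (f - h)"
proof -
  obtain a b where ab: "b \<noteq> 0" "f = Fract a b" "a = 0 \<or> degree a < degree b"
    using assms(1) unfolding strictly_proper_def by blast
  obtain c d where cd: "d \<noteq> 0" "h = Fract c d" "c = 0 \<or> degree c < degree d"
    using assms(2) unfolding strictly_proper_def by blast
  have eq: "f - h = Fract (a * d - c * b) (b * d)" using ab cd by simp
  have "a * d = 0 \<or> degree (a * d) < degree (b * d)"
    using ab cd by (cases "a = 0") (auto simp: degree_mult_eq)
  moreover have "c * b = 0 \<or> degree (c * b) < degree (b * d)"
    using ab cd by (cases "c = 0") (auto simp: degree_mult_eq)
  ultimately have "a * d - c * b = 0 \<or> degree (a * d - c * b) < degree (b * d)"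
    by (auto intro: degree_diff_less)
  thus ?thesis unfolding strictly_proper_def eq
    using ab(1) cd(1) by (intro exI[of _ "a * d - c * b"] exI[of _ "b * d"]) auto
qed

lemma strictly_proper_to_fract:
  assumes "strictly_proper (to_fract p)"
  shows "p = 0"
proof (rule ccontr)
  assume p: "p \<noteq> 0"
  obtain a b where ab: "b \<noteq> 0" "to_fract p = Fract a b" "a = 0 \<or> degree a < degree b"
    using assms unfolding strictly_proper_def by blast
  have "p * b = a" using ab by (simp add: to_fract_def eq_fract)
  hence "a \<noteq> 0" "degree a = degree p + degree b" using p ab by (auto simp: degree_mult_eq)
  thus False using ab by simp
qed

lemma polynomial_part_entry:
  "\<exists>p. strictly_proper (f - to_fract p)"
proof -
  obtain a b where ab: "f = Fract a b" "b \<noteq> 0" by (cases f) auto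
  have "f - to_fract (a div b) = Fract (a mod b) b"
    using ab by (simp add: to_fract_def minus_div_mult_eq_mod)
  thus ?thesis unfolding strictly_proper_def
    using ab(2) degree_mod_less[OF ab(2), of a] by (metis)
qed

lemma polynomial_part_unique_existence:
  "\<exists>!Q. Q \<in> carrier_mat (dim_row G) (dim_col G) \<and>
     (\<exists>Gsp \<in> carrier_mat (dim_row G) (dim_col G).
        strictly_proper_mat Gsp \<and> G = map_mat to_fract Q + Gsp)"
proof -
  let ?p = "dim_row G" and ?m = "dim_col G"
  define P where "P i j = (SOME p. strictly_proper (G $$ (i, j) - to_fract p))" for i j
  have P: "strictly_proper (G $$ (i, j) - to_fract (P i j))" for i j
    unfolding P_def by (rule someI_ex[OF polynomial_part_entry])
  let ?Q = "mat ?p ?m (\<lambda>(i, j). P i j)"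
  let ?S = "mat ?p ?m (\<lambda>(i, j). G $$ (i, j) - to_fract (P i j))"
  show ?thesis
  proof (rule ex1I[of _ ?Q], intro conjI bexI[of _ ?S])
    show "G = map_mat to_fract ?Q + ?S" by (rule eq_matI) auto
  next
    fix Q assume "Q \<in> carrier_mat ?p ?m \<and>
     (\<exists>Gsp \<in> carrier_mat ?p ?m. strictly_proper_mat Gsp \<and> G = map_mat to_fract Q + Gsp)"
    then obtain S where Q: "Q \<in> carrier_mat ?p ?m" and S: "S \<in> carrier_mat ?p ?m"
      and sp: "strictly_proper_mat S" and G: "G = map_mat to_fract Q + S" by blast
    show "Q = ?Q"
    proof (rule eq_matI)
      fix i j assume "i < dim_row ?Q" "j < dim_col ?Q"
      hence ij: "i < ?p" "j < ?m" by auto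
      have "G $$ (i, j) = to_fract (Q $$ (i, j)) + S $$ (i, j)"
        using ij Q S by (subst G) auto
      hence "to_fract (Q $$ (i, j) - P i j) = (G $$ (i, j) - to_fract (P i j)) - S $$ (i, j)"
        by simp
      moreover have "strictly_proper (S $$ (i, j))"
        using sp ij S unfolding strictly_proper_mat_def by auto
      ultimately have "strictly_proper (to_fract (Q $$ (i, j) - P i j))"
        using strictly_proper_diff[OF P] by metis
      hence "Q $$ (i, j) - P i j = 0" by (rule strictly_proper_to_fract)
      thus "Q $$ (i, j) = ?Q $$ (i, j)" using ij by simp
    qed (use Q in auto)
  qed (use P in \<open>auto simp: strictly_proper_mat_def\<close>)
qed

end

theory Submission
  imports Defs "Jordan_Normal_Form.Char_Poly"
begin

text \<open>Two matrices without poles at a point are equivalent over the local ring of that point as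
  soon as their direct sums with the same identity matrix are; this cancellation replaces Smith
  forms throughout. Since \<open>A\<^sub>1\<close> is invertible, the transfer function is \<open>M \<lambda> + N\<close> plus a
  strictly proper matrix with \<open>M = D\<^sub>1 + C\<^sub>1 A\<^sub>1\<^sup>-\<^sup>1 B\<^sub>1\<close>, so its natural reversal has grade \<open>1\<close>
  or \<open>0\<close> according to whether \<open>M\<close> is nonzero, whereas the system matrix has degree \<open>1\<close>.
  If \<open>M = 0\<close>, let \<open>X\<close> and \<open>Y\<close> be the natural reversals of \<open>G\<close> and of the transfer
  function; they are equivalent up to identity blocks, and strongness asks the same of
  \<open>\<lambda>\<^sup>k X\<close> and \<open>\<lambda> Y\<close> for some \<open>k\<close>. For equal sizes the identity blocks cancel and
  \<open>k = 1\<close> works. If \<open>Y\<close> is larger than \<open>X\<close>, then \<open>\<lambda> Y\<close>, which vanishes at \<open>0\<close>,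
  would be equivalent to a matrix with an entry \<open>1\<close>. If \<open>Y\<close> is smaller, comparing the powers
  of \<open>\<lambda>\<close> that can be divided out forces \<open>k = 0\<close>; then \<open>Y\<close> is equivalent to \<open>\<lambda> Y\<close>,
  so \<open>Y = 0\<close>. But the state matrix is singular at some point, the field being algebraically
  closed, and by minimality the transfer function has a pole there.\<close>

section \<open>The local ring of rational functions without a pole at a point\<close>

lemma not_has_poleE:
  assumes "\<not> has_pole f x"
  obtains a b where "f = Fract a b" "poly b x \<noteq> 0" "b \<noteq> 0"
  using assms unfolding not_has_pole_iff by fastforce

lemma not_has_pole_Fract: "poly b x \<noteq> 0 \<Longrightarrow> \<not> has_pole (Fract a b) x"
  unfolding not_has_pole_iff by blast

lemma not_has_pole_to_fract [simp]: "\<not> has_pole (to_fract a) x"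
  unfolding to_fract_def by (rule not_has_pole_Fract) simp

lemma rat_eval_to_fract [simp]: "rat_eval (to_fract a) x = poly a x"
  unfolding to_fract_def by (subst rat_eval_Fract) simp_all

lemma not_has_pole_0 [simp]: "\<not> has_pole 0 x" and rat_eval_0 [simp]: "rat_eval 0 x = 0"
  using not_has_pole_to_fract[of 0 x] rat_eval_to_fract[of 0 x] by simp_all

lemma not_has_pole_1 [simp]: "\<not> has_pole 1 x" and rat_eval_1 [simp]: "rat_eval 1 x = 1"
  using not_has_pole_to_fract[of 1 x] rat_eval_to_fract[of 1 x] by simp_all

lemma
  assumes "\<not> has_pole f x" "\<not> has_pole h x"
  shows not_has_pole_add: "\<not> has_pole (f + h) x"
    and rat_eval_add: "rat_eval (f + h) x = rat_eval f x + rat_eval h x"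
    and not_has_pole_mult: "\<not> has_pole (f * h) x"
    and rat_eval_mult: "rat_eval (f * h) x = rat_eval f x * rat_eval h x"
proof -
  obtain a b where f: "f = Fract a b" "poly b x \<noteq> 0" "b \<noteq> 0"
    using assms(1) by (rule not_has_poleE)
  obtain c d where h: "h = Fract c d" "poly d x \<noteq> 0" "d \<noteq> 0"
    using assms(2) by (rule not_has_poleE)
  have s: "f + h = Fract (a * d + c * b) (b * d)" and p: "f * h = Fract (a * c) (b * d)"
    using f h by simp_all
  have nz: "poly (b * d) x \<noteq> 0" using f h by simp
  show "\<not> has_pole (f + h) x" "\<not> has_pole (f * h) x"
    unfolding s p using nz by (simp_all only: not_has_pole_Fract not_False_eq_True)
  show "rat_eval (f + h) x = rat_eval f x + rat_eval h x"
    "rat_eval (f * h) x = rat_eval f x * rat_eval h x"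
    unfolding s p using nz f h
    by (simp_all only: rat_eval_Fract) (simp_all add: rat_eval_Fract field_simps)
qed

lemma not_has_pole_uminus: "\<not> has_pole f x \<Longrightarrow> \<not> has_pole (- f) x"
  using not_has_pole_mult[OF not_has_pole_to_fract[of "-1"]] by fastforce

text \<open>The functions with nonzero value at \<open>x\<close> are the units of the local
  ring.\<close>

lemma not_has_pole_inverse:
  assumes "\<not> has_pole f x" "rat_eval f x \<noteq> 0"
  shows "\<not> has_pole (inverse f) x"
proof -
  obtain a b where f: "f = Fract a b" "poly b x \<noteq> 0" "b \<noteq> 0"
    using assms(1) by (rule not_has_poleE)
  have "poly a x \<noteq> 0" using assms(2) f by (simp add: rat_eval_Fract)
  thus ?thesis using f by (simp add: not_has_pole_Fract)
qed

lemma not_has_pole_sum: "(\<And>i. i \<in> S \<Longrightarrow> \<not> has_pole (f i) x) \<Longrightarrow> \<not> has_pole (sum f S) x"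
  by (induction S rule: infinite_finite_induct) (simp_all add: not_has_pole_add)

lemma not_has_pole_prod: "(\<And>i. i \<in> S \<Longrightarrow> \<not> has_pole (f i) x) \<Longrightarrow> \<not> has_pole (prod f S) x"
  by (induction S rule: infinite_finite_induct) (simp_all add: not_has_pole_mult)

lemma not_has_pole_power: "\<not> has_pole f x \<Longrightarrow> \<not> has_pole (f ^ k) x"
  by (induction k) (simp_all add: not_has_pole_mult)

section \<open>Regular matrices and equivalence at a point\<close>

text \<open>Matrices over the local ring at \<open>x\<close>; unlike in \<open>regular_at\<close>,
  rectangular ones are allowed.\<close>

definition pole_free :: "'a::field poly fract mat \<Rightarrow> 'a \<Rightarrow> bool" where
  "pole_free M x \<longleftrightarrow> (\<forall>i<dim_row M. \<forall>j<dim_col M. \<not> has_pole (M $$ (i, j)) x)"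

lemma pole_free_one [simp]: "pole_free (1\<^sub>m k) x"
  by (auto simp: pole_free_def)

lemma pole_free_mult:
  assumes "pole_free M x" "pole_free N x" "dim_col M = dim_row N"
  shows "pole_free (M * N) x"
  using assms unfolding pole_free_def
  by (auto simp: scalar_prod_def not_has_pole_mult intro!: not_has_pole_sum)

lemma pole_free_smult: "\<not> has_pole c x \<Longrightarrow> pole_free M x \<Longrightarrow> pole_free (c \<cdot>\<^sub>m M) x"
  by (auto simp: pole_free_def not_has_pole_mult)

lemma pole_free_four_block:
  assumes "A \<in> carrier_mat k m" "B \<in> carrier_mat k m'" "C \<in> carrier_mat k' m"
    "D \<in> carrier_mat k' m'"
  shows "pole_free (four_block_mat A B C D) x \<longleftrightarrow>
    pole_free A x \<and> pole_free B x \<and> pole_free C x \<and> pole_free D x" (is "?L \<longleftrightarrow> ?R")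
proof
  assume R: ?R
  thus ?L using assms by (auto simp: pole_free_def)
next
  assume L: ?L
  have l: "\<not> has_pole (four_block_mat A B C D $$ (i, j)) x" if "i < k + k'" "j < m + m'" for i j
    using L that assms by (auto simp: pole_free_def)
  show ?R unfolding pole_free_def
  proof (intro conjI allI impI)
    fix i j assume "i < dim_row A" "j < dim_col A"
    thus "\<not> has_pole (A $$ (i, j)) x" using l[of i j] assms by auto
  next
    fix i j assume "i < dim_row B" "j < dim_col B"
    thus "\<not> has_pole (B $$ (i, j)) x" using l[of i "m + j"] assms by auto
  next
    fix i j assume "i < dim_row C" "j < dim_col C"
    thus "\<not> has_pole (C $$ (i, j)) x" using l[of "k + i" j] assms by auto
  next
    fix i j assume "i < dim_row D" "j < dim_col D"
    thus "\<not> has_pole (D $$ (i, j)) x" using l[of "k + i" "m + j"] assms by auto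
  qed
qed

lemma pole_free_zero [simp]: "pole_free (0\<^sub>m k m) x"
  by (auto simp: pole_free_def)

lemma not_has_pole_det:
  assumes "pole_free M x" "M \<in> carrier_mat k k"
  shows "\<not> has_pole (det M) x"
proof -
  have "\<not> has_pole (signof p :: 'a poly fract) x" for p :: "nat \<Rightarrow> nat"
    by (auto simp: sign_def not_has_pole_uminus)
  thus ?thesis unfolding det_def'[OF assms(2)] using assms
    by (intro not_has_pole_sum not_has_pole_mult not_has_pole_prod)
      (auto simp: pole_free_def permutes_in_image)
qed

lemma not_has_pole_cofactor:
  assumes "pole_free M x" "M \<in> carrier_mat k k" "i < k" "j < k"
  shows "\<not> has_pole (cofactor M i j) x"
proof -
  have "pole_free (mat_delete M i j) x"
    using assms unfolding pole_free_def mat_delete_def by auto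
  hence "\<not> has_pole (det (mat_delete M i j)) x"
    by (rule not_has_pole_det[of _ _ "k - 1"]) (use assms in \<open>simp add: mat_delete_def\<close>)
  thus ?thesis unfolding cofactor_def
    by (intro not_has_pole_mult not_has_pole_power) (simp_all add: not_has_pole_uminus)
qed

lemma regular_at_iff:
  assumes "M \<in> carrier_mat k k"
  shows "regular_at M x \<longleftrightarrow> pole_free M x \<and> rat_eval (det M) x \<noteq> 0"
  using assms by (auto simp: regular_at_def pole_free_def)

lemma regular_at_mult:
  assumes "regular_at M x" "regular_at N x" "M \<in> carrier_mat k k" "N \<in> carrier_mat k k"
  shows "regular_at (M * N) x"
proof -
  have "pole_free (M * N) x"
    using assms by (intro pole_free_mult) (auto simp: regular_at_iff)
  thus ?thesis using assms
    by (simp add: regular_at_iff[of _ k] det_mult[of _ k] rat_eval_mult not_has_pole_det)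
qed

text \<open>Cramer's rule stays inside the local ring: cofactors have no pole, and the determinant
  is a unit. Hence \<open>regular_at\<close> means invertibility over that ring.\<close>

lemma regular_at_inverse:
  assumes "regular_at M x" "M \<in> carrier_mat k k"
  obtains N where "regular_at N x" "N \<in> carrier_mat k k" "M * N = 1\<^sub>m k" "N * M = 1\<^sub>m k"
proof
  let ?d = "det M"
  define N where "N = inverse ?d \<cdot>\<^sub>m adj_mat M"
  have pf: "pole_free M x" and ev: "rat_eval ?d x \<noteq> 0"
    using assms by (simp_all add: regular_at_iff)
  have d0: "?d \<noteq> 0" using ev by auto
  show N: "N \<in> carrier_mat k k" unfolding N_def using adj_mat(1)[OF assms(2)] by simp
  have "M * N = inverse ?d \<cdot>\<^sub>m (?d \<cdot>\<^sub>m 1\<^sub>m k)"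
    unfolding N_def mult_smult_distrib[OF assms(2) adj_mat(1)[OF assms(2)]] adj_mat(2)[OF assms(2)] ..
  also have "\<dots> = 1\<^sub>m k" using d0 by (intro eq_matI) auto
  finally show MN: "M * N = 1\<^sub>m k" .
  show "N * M = 1\<^sub>m k" using mat_mult_left_right_inverse[OF assms(2) N MN] .
  have "pole_free (adj_mat M) x"
    using not_has_pole_cofactor[OF pf assms(2)] assms(2)
    by (auto simp: pole_free_def adj_mat_def)
  hence pN: "pole_free N x" unfolding N_def
    by (intro pole_free_smult not_has_pole_inverse not_has_pole_det[OF pf assms(2)] ev)
  have "det M * det N = 1" using MN det_mult[OF assms(2) N] by simp
  hence "rat_eval ?d x * rat_eval (det N) x = 1"
    using rat_eval_mult[OF not_has_pole_det[OF pf assms(2)] not_has_pole_det[OF pN N]] by simp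
  thus "regular_at N x" using pN N by (auto simp: regular_at_iff)
qed

section \<open>Equivalence of matrices over the local ring\<close>

lemma nested_mult_assoc:
  assumes "P' \<in> carrier_mat k k" "P \<in> carrier_mat k k" "X \<in> carrier_mat k m"
    "Q \<in> carrier_mat m m" "Q' \<in> carrier_mat m m"
  shows "P' * (P * X * Q) * Q' = P' * P * X * (Q * Q')"
proof -
  have PX: "P * X \<in> carrier_mat k m" and PXQ: "P * X * Q \<in> carrier_mat k m"
    and QQ: "Q * Q' \<in> carrier_mat m m"
    using assms by auto
  show ?thesis
    unfolding assoc_mult_mat[OF assms(1) PXQ assms(5)] assoc_mult_mat[OF PX assms(4,5)]
      assoc_mult_mat[OF assms(1) PX QQ, symmetric] assoc_mult_mat[OF assms(1-3)] ..
qed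

definition equivalent_at ::
  "'a::field \<Rightarrow> 'a poly fract mat \<Rightarrow> 'a poly fract mat \<Rightarrow> bool" where
  "equivalent_at x X Y \<longleftrightarrow>
     (\<exists>P \<in> carrier_mat (dim_row X) (dim_row X). \<exists>Q \<in> carrier_mat (dim_col X) (dim_col X).
        regular_at P x \<and> regular_at Q x \<and> P * X * Q = Y)"

lemma equivalent_at_dim:
  assumes "equivalent_at x X Y"
  shows "dim_row Y = dim_row X" "dim_col Y = dim_col X"
  using assms by (auto simp: equivalent_at_def)

lemma equivalent_at_sym:
  assumes "equivalent_at x X Y"
  shows "equivalent_at x Y X"
proof -
  let ?k = "dim_row X" and ?m = "dim_col X"
  obtain P Q where P: "P \<in> carrier_mat ?k ?k" "regular_at P x"
    and Q: "Q \<in> carrier_mat ?m ?m" "regular_at Q x" and eq: "P * X * Q = Y"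
    using assms by (auto simp: equivalent_at_def)
  obtain P' where P': "regular_at P' x" "P' \<in> carrier_mat ?k ?k" "P' * P = 1\<^sub>m ?k"
    using regular_at_inverse[OF P(2,1)] by metis
  obtain Q' where Q': "regular_at Q' x" "Q' \<in> carrier_mat ?m ?m" "Q * Q' = 1\<^sub>m ?m"
    using regular_at_inverse[OF Q(2,1)] by metis
  have "P' * Y * Q' = X"
    unfolding eq[symmetric] nested_mult_assoc[OF P'(2) P(1) carrier_matI[OF refl refl] Q(1) Q'(2)]
    by (simp add: P'(3) Q'(3) left_mult_one_mat[of X ?k ?m] right_mult_one_mat[of X ?k ?m])
  thus ?thesis unfolding equivalent_at_def using P' Q' equivalent_at_dim[OF assms] by metis
qed

lemma equivalent_at_trans:
  assumes "equivalent_at x X Y" "equivalent_at x Y Z"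
  shows "equivalent_at x X Z"
proof -
  let ?k = "dim_row X" and ?m = "dim_col X"
  obtain P Q where P: "P \<in> carrier_mat ?k ?k" "regular_at P x"
    and Q: "Q \<in> carrier_mat ?m ?m" "regular_at Q x" and eq: "P * X * Q = Y"
    using assms(1) by (auto simp: equivalent_at_def)
  obtain P' Q' where P': "P' \<in> carrier_mat ?k ?k" "regular_at P' x"
    and Q': "Q' \<in> carrier_mat ?m ?m" "regular_at Q' x" and eq': "P' * Y * Q' = Z"
    using assms(2) equivalent_at_dim[OF assms(1)] by (auto simp: equivalent_at_def)
  have "Z = (P' * P) * X * (Q * Q')"
    unfolding eq[symmetric] eq'[symmetric]
    by (rule nested_mult_assoc[OF P'(1) P(1) carrier_matI[OF refl refl] Q(1) Q'(1)])
  thus ?thesis unfolding equivalent_at_def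
    using regular_at_mult[OF P'(2) P(2) P'(1) P(1)] regular_at_mult[OF Q(2) Q'(2) Q(1) Q'(1)]
      mult_carrier_mat[OF P'(1) P(1)] mult_carrier_mat[OF Q(1) Q'(1)] by blast
qed

lemma equivalent_at_smult:
  assumes "equivalent_at x X Y"
  shows "equivalent_at x (c \<cdot>\<^sub>m X) (c \<cdot>\<^sub>m Y)"
proof -
  let ?k = "dim_row X" and ?m = "dim_col X"
  obtain P Q where P: "P \<in> carrier_mat ?k ?k" "regular_at P x"
    and Q: "Q \<in> carrier_mat ?m ?m" "regular_at Q x" and eq: "P * X * Q = Y"
    using assms by (auto simp: equivalent_at_def)
  have X: "X \<in> carrier_mat ?k ?m" by simp
  have "P * (c \<cdot>\<^sub>m X) * Q = c \<cdot>\<^sub>m Y"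
    unfolding eq[symmetric] mult_smult_distrib[OF P(1) X]
    by (rule mult_smult_assoc_mat[OF mult_carrier_mat[OF P(1) X] Q(1)])
  thus ?thesis unfolding equivalent_at_def using P Q by auto
qed

lemma equivalent_at_pole_free:
  assumes "equivalent_at x X Y" "pole_free X x"
  shows "pole_free Y x"
  using assms by (auto simp: equivalent_at_def regular_at_iff intro!: pole_free_mult)

text \<open>This is the invariant that replaces Smith forms: with \<open>c\<close> a power of the
  variable, it says that equivalent matrices allow the same powers to be divided out.\<close>

lemma equivalent_at_pole_free_smult_iff:
  assumes "equivalent_at x X Y"
  shows "pole_free (c \<cdot>\<^sub>m X) x \<longleftrightarrow> pole_free (c \<cdot>\<^sub>m Y) x"
  using equivalent_at_smult[OF assms] equivalent_at_smult[OF equivalent_at_sym[OF assms]]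
    equivalent_at_pole_free by blast

section \<open>Cancellation of identity blocks\<close>

text \<open>The direct sum with an identity matrix, encoded by four blocks so that the block product
  rules apply directly.\<close>

definition pad :: "nat \<Rightarrow> 'a::{zero,one} mat \<Rightarrow> 'a mat" where
  "pad s X = four_block_mat X (0\<^sub>m (dim_row X) s) (0\<^sub>m s (dim_col X)) (1\<^sub>m s)"

lemma dim_pad [simp]: "dim_row (pad s X) = dim_row X + s" "dim_col (pad s X) = dim_col X + s"
  by (simp_all add: pad_def)

lemma index_pad:
  assumes "i < dim_row X + s" "j < dim_col X + s"
  shows "pad s X $$ (i, j) =
    (if i < dim_row X \<and> j < dim_col X then X $$ (i, j)
     else if dim_row X \<le> i \<and> dim_col X \<le> j \<and> i - dim_row X = j - dim_col X then 1 else 0)"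
  using assms by (auto simp: pad_def)

lemma diag_block_mat_eq_pad: "diag_block_mat [X, 1\<^sub>m s] = pad s X"
  unfolding diag_block_mat.simps(2)[of X] diag_block_mat_singleton by (simp add: pad_def Let_def)

lemma pad_0 [simp]: "pad 0 X = X"
  by (intro eq_matI) (simp_all add: index_pad)

lemma pad_pad: "pad s (pad t X) = pad (t + s) X"
proof (intro eq_matI)
  fix i j assume "i < dim_row (pad (t + s) X)" "j < dim_col (pad (t + s) X)"
  hence ij: "i < dim_row X + (t + s)" "j < dim_col X + (t + s)" by simp_all
  hence "i < dim_row (pad t X) + s" "j < dim_col (pad t X) + s" by simp_all
  thus "pad s (pad t X) $$ (i, j) = pad (t + s) X $$ (i, j)"
    using ij by (simp only: index_pad dim_pad) (auto simp: index_pad)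
qed simp_all

lemma pole_free_pad_iff: "pole_free (pad s X) x \<longleftrightarrow> pole_free X x"
  unfolding pad_def
  by (subst pole_free_four_block[of _ "dim_row X" "dim_col X" _ s _ s]) auto

lemma padded_equivalent_at_iff:
  "padded_equivalent_at x s1 s2 G H \<longleftrightarrow> equivalent_at x (pad s1 G) (pad s2 H)"
  unfolding padded_equivalent_at_def equivalent_at_def diag_block_mat_eq_pad dim_pad by blast

section \<open>Cancellation of a single diagonal entry 1\<close>

lemma regular_at_lower_elementary:
  assumes "U \<in> carrier_mat 1 k" "pole_free U x"
  shows "regular_at (four_block_mat (1\<^sub>m k) (0\<^sub>m k 1) U (1\<^sub>m 1)) x"
proof -
  have "det (four_block_mat (1\<^sub>m k) (0\<^sub>m k 1) U (1\<^sub>m 1)) = 1"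
    using assms by (subst det_four_block_mat_upper_right_zero[of _ k _ 1]) auto
  moreover have "pole_free (four_block_mat (1\<^sub>m k) (0\<^sub>m k 1) U (1\<^sub>m 1)) x"
    using assms by (subst pole_free_four_block[of _ k k _ 1 _ 1]) auto
  ultimately show ?thesis using assms by (subst regular_at_iff[of _ "k + 1"]) auto
qed

text \<open>Jacobi's identity for complementary minors: \<open>det P1\<close> is the corner cofactor
  of \<open>P\<close>, hence \<open>det P\<close> times the corner entry of the inverse
  \<open>S\<close>. If that entry is a unit, so is \<open>det P1\<close>.\<close>

lemma leading_block_regular:
  assumes P: "regular_at P x" "P \<in> carrier_mat (k + 1) (k + 1)"
    and S: "S \<in> carrier_mat (k + 1) (k + 1)" "S * P = 1\<^sub>m (k + 1)"
    and ev: "rat_eval (S $$ (k, k)) x \<noteq> 0"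
    and blocks: "P = four_block_mat P1 P2 P3 P4" "P1 \<in> carrier_mat k k" "P2 \<in> carrier_mat k 1"
      "P3 \<in> carrier_mat 1 k" "P4 \<in> carrier_mat 1 1"
  shows "regular_at P1 x"
proof -
  have pf: "pole_free P x" and evP: "rat_eval (det P) x \<noteq> 0"
    using P by (simp_all add: regular_at_iff)
  have pf1: "pole_free P1 x"
    using pf blocks pole_free_four_block[of P1 k k P2 1 P3 1 P4 x] by simp
  have adj: "adj_mat P = det P \<cdot>\<^sub>m S"
  proof -
    have "adj_mat P = S * P * adj_mat P"
      using S(2) adj_mat(1)[OF P(2)] by simp
    also have "\<dots> = S * (P * adj_mat P)"
      using assoc_mult_mat[OF S(1) P(2) adj_mat(1)[OF P(2)]] .
    also have "\<dots> = det P \<cdot>\<^sub>m S"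
      unfolding adj_mat(2)[OF P(2)] mult_smult_distrib[OF S(1) one_carrier_mat] using S(1) by simp
    finally show ?thesis .
  qed
  have "mat_delete P k k = P1"
    using blocks by (intro eq_matI) (auto simp: mat_delete_def)
  hence "det P1 = adj_mat P $$ (k, k)"
    using P(2) by (simp add: adj_mat_def cofactor_def flip: mult_2)
  also have "\<dots> = det P * S $$ (k, k)" unfolding adj using S(1) by simp
  finally have det: "det P1 = det P * S $$ (k, k)" .
  \<comment> \<open>\<open>S\<close> is only given as a left inverse; it coincides with the inverse
    \<open>N\<close> over the local ring.\<close>
  have S': "\<not> has_pole (S $$ (k, k)) x"
  proof -
    obtain N where N: "regular_at N x" "N \<in> carrier_mat (k + 1) (k + 1)" "P * N = 1\<^sub>m (k + 1)"
      using regular_at_inverse[OF P] by metis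
    have "S = S * (P * N)" using N(3) S(1) by simp
    also have "\<dots> = N" using assoc_mult_mat[OF S(1) P(2) N(2)] S(2) N(2) by simp
    finally show ?thesis using N by (auto simp: regular_at_iff pole_free_def)
  qed
  have "rat_eval (det P1) x \<noteq> 0"
    unfolding det using rat_eval_mult[OF not_has_pole_det[OF pf P(2)] S'] ev evP by simp
  thus ?thesis using pf1 blocks by (simp add: regular_at_iff)
qed

text \<open>Adding multiples of the rows of \<open>X\<close> to the last row is matched by a column
  operation on the other side, so the elementary factor yields an automorphism of
  \<open>pad 1 X\<close>.\<close>

lemma pad_mult_elementary:
  fixes X :: "'a::ring_1 mat"
  assumes X: "X \<in> carrier_mat k m" and U: "U \<in> carrier_mat 1 k"
  shows "four_block_mat (1\<^sub>m k) (0\<^sub>m k 1) U (1\<^sub>m 1) * pad 1 X =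
    pad 1 X * four_block_mat (1\<^sub>m m) (0\<^sub>m m 1) (U * X) (1\<^sub>m 1)"
proof -
  have UX: "U * X \<in> carrier_mat 1 m" using assms by simp
  have "four_block_mat (1\<^sub>m k) (0\<^sub>m k 1) U (1\<^sub>m 1) * pad 1 X =
      four_block_mat X (0\<^sub>m k 1) (U * X) (1\<^sub>m 1)"
    using assms unfolding pad_def
    by (subst mult_four_block_mat[of _ k k _ 1 _ 1 _ _ m _ 1])
      (auto simp: left_mult_one_mat[OF X] right_add_zero_mat[OF X]
        left_mult_one_mat[OF one_carrier_mat])
  also have "\<dots> = pad 1 X * four_block_mat (1\<^sub>m m) (0\<^sub>m m 1) (U * X) (1\<^sub>m 1)"
    using assms UX unfolding pad_def
    by (subst mult_four_block_mat[of _ k m _ 1 _ 1 _ _ m _ 1]) auto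
  finally show ?thesis .
qed

text \<open>With the right factor moved across, the leading blocks read
  \<open>P1 * X = Y * T1\<close>, so it is enough that \<open>P1\<close> and \<open>T1\<close> are
  regular. For \<open>P1\<close> this is the assumption on the corner of \<open>S\<close>. For
  \<open>T1\<close>, the identity \<open>pad 1 X * Q = S * pad 1 Y\<close> with \<open>Q\<close>
  inverse to \<open>T\<close> shows that \<open>Q\<close> and \<open>S\<close> have the same corner
  entry.\<close>

lemma equivalent_at_cancel_1_aux:
  assumes X: "X \<in> carrier_mat k m" and Y: "Y \<in> carrier_mat k m"
    and P: "regular_at P x" "P \<in> carrier_mat (k + 1) (k + 1)"
    and T: "regular_at T x" "T \<in> carrier_mat (m + 1) (m + 1)"
    and eq: "P * pad 1 X = pad 1 Y * T"
    and S: "S \<in> carrier_mat (k + 1) (k + 1)" "S * P = 1\<^sub>m (k + 1)"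
    and ev: "rat_eval (S $$ (k, k)) x \<noteq> 0"
  shows "equivalent_at x X Y"
proof -
  obtain P1 P2 P3 P4 where sP: "split_block P k k = (P1, P2, P3, P4)" by (metis prod_cases4)
  note Pb = split_block[OF sP, of 1 1]
  obtain T1 T2 T3 T4 where sT: "split_block T m m = (T1, T2, T3, T4)" by (metis prod_cases4)
  note Tb = split_block[OF sT, of 1 1]
  have Pb: "P1 \<in> carrier_mat k k" "P2 \<in> carrier_mat k 1" "P3 \<in> carrier_mat 1 k"
      "P4 \<in> carrier_mat 1 1" "P = four_block_mat P1 P2 P3 P4"
    and Tb: "T1 \<in> carrier_mat m m" "T2 \<in> carrier_mat m 1" "T3 \<in> carrier_mat 1 m"
      "T4 \<in> carrier_mat 1 1" "T = four_block_mat T1 T2 T3 T4"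
    using Pb Tb P(2) T(2) by auto
  obtain Q where Q: "Q \<in> carrier_mat (m + 1) (m + 1)" "T * Q = 1\<^sub>m (m + 1)" "Q * T = 1\<^sub>m (m + 1)"
    using regular_at_inverse[OF T] by metis
  have pX: "pad 1 X \<in> carrier_mat (k + 1) (m + 1)" and pY: "pad 1 Y \<in> carrier_mat (k + 1) (m + 1)"
    using X Y by (auto intro: carrier_matI)
  have P1: "regular_at P1 x"
    by (rule leading_block_regular[OF P S ev Pb(5) Pb(1-4)])
  have "pad 1 X * Q = S * P * pad 1 X * Q" using S(2) left_mult_one_mat[OF pX] by simp
  also have "\<dots> = S * (pad 1 Y * T) * Q"
    unfolding assoc_mult_mat[OF S(1) P(2) pX] eq ..
  also have "\<dots> = S * (pad 1 Y * T * Q)"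
    using assoc_mult_mat[OF S(1) mult_carrier_mat[OF pY T(2)] Q(1)] .
  also have "pad 1 Y * T * Q = pad 1 Y"
    unfolding assoc_mult_mat[OF pY T(2) Q(1)] Q(2) using right_mult_one_mat[OF pY] .
  finally have "(pad 1 X * Q) $$ (k, m) = (S * pad 1 Y) $$ (k, m)" by simp
  moreover have "(pad 1 X * Q) $$ (k, m) = Q $$ (m, m)"
  proof -
    have "(pad 1 X * Q) $$ (k, m) = (\<Sum>i = 0..<m + 1. pad 1 X $$ (k, i) * Q $$ (i, m))"
      using pX Q(1) X by (simp add: scalar_prod_def)
    also have "\<dots> = (\<Sum>i = 0..<m + 1. if i = m then Q $$ (m, m) else 0)"
      using X by (intro sum.cong) (auto simp: index_pad)
    finally show ?thesis by simp
  qed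
  moreover have "(S * pad 1 Y) $$ (k, m) = S $$ (k, k)"
  proof -
    have "(S * pad 1 Y) $$ (k, m) = (\<Sum>i = 0..<k + 1. S $$ (k, i) * pad 1 Y $$ (i, m))"
      using pY S(1) Y by (simp add: scalar_prod_def)
    also have "\<dots> = (\<Sum>i = 0..<k + 1. if i = k then S $$ (k, k) else 0)"
      using Y by (intro sum.cong) (auto simp: index_pad)
    finally show ?thesis by simp
  qed
  ultimately have evQ: "rat_eval (Q $$ (m, m)) x \<noteq> 0" using ev by simp
  have T1: "regular_at T1 x"
    by (rule leading_block_regular[OF T Q(1,3) evQ Tb(5) Tb(1-4)])
  have b1: "P * pad 1 X = four_block_mat (P1 * X) P2 (P3 * X) P4"
    unfolding Pb(5) pad_def using Pb(1-4) X
    by (subst mult_four_block_mat[of _ k k _ 1 _ 1 _ _ m _ 1]) auto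
  have b2: "pad 1 Y * T = four_block_mat (Y * T1) (Y * T2) T3 T4"
    unfolding Tb(5) pad_def using Tb(1-4) Y
    by (subst mult_four_block_mat[of _ k m _ 1 _ 1 _ _ m _ 1]) auto
  have PX: "P1 * X = Y * T1"
  proof (rule eq_matI)
    fix i j assume "i < dim_row (Y * T1)" "j < dim_col (Y * T1)"
    hence ij: "i < k" "j < m" using Y Tb by auto
    have "four_block_mat (P1 * X) P2 (P3 * X) P4 $$ (i, j)
        = four_block_mat (Y * T1) (Y * T2) T3 T4 $$ (i, j)"
      using eq unfolding b1 b2 by simp
    thus "(P1 * X) $$ (i, j) = (Y * T1) $$ (i, j)" using ij Pb Tb X Y by simp
  qed (use Pb Tb X Y in auto)
  obtain T' where T': "regular_at T' x" "T' \<in> carrier_mat m m" "T1 * T' = 1\<^sub>m m"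
    using regular_at_inverse[OF T1 Tb(1)] by metis
  have "P1 * X * T' = Y"
    unfolding PX assoc_mult_mat[OF Y Tb(1) T'(2)] T'(3) using right_mult_one_mat[OF Y] .
  thus ?thesis unfolding equivalent_at_def using P1 T'(1,2) Pb(1) X by auto
qed

text \<open>Over a local ring the corner entry \<open>\<sigma>\<close> of \<open>P\<^sup>-\<^sup>1\<close> can be made a unit by means of an
  automorphism of \<open>pad 1 X\<close>: if \<open>\<sigma>\<close> is not a unit, the matrix \<open>E\<close> below replaces it by
  \<open>1 + (1 - \<pi>)\<sigma>\<close>, where \<open>\<pi>\<close> is the corner entry of \<open>P\<close>.\<close>

lemma equivalent_at_cancel_1:
  assumes X: "pole_free X x" and eqv: "equivalent_at x (pad 1 X) (pad 1 Y)"
  shows "equivalent_at x X Y"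
proof -
  define k m where "k = dim_row X" and "m = dim_col X"
  have XY: "X \<in> carrier_mat k m" "Y \<in> carrier_mat k m"
    using equivalent_at_dim[OF eqv] by (auto simp: k_def m_def)
  have pX: "pad 1 X \<in> carrier_mat (k + 1) (m + 1)" and pY: "pad 1 Y \<in> carrier_mat (k + 1) (m + 1)"
    using XY by (auto intro: carrier_matI)
  obtain P Q where P: "regular_at P x" "P \<in> carrier_mat (k + 1) (k + 1)"
    and Q: "regular_at Q x" "Q \<in> carrier_mat (m + 1) (m + 1)"
    and eq: "P * pad 1 X * Q = pad 1 Y"
    using eqv XY unfolding equivalent_at_def by auto
  obtain T where T: "regular_at T x" "T \<in> carrier_mat (m + 1) (m + 1)" "Q * T = 1\<^sub>m (m + 1)"
    using regular_at_inverse[OF Q] by metis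
  have PT: "P * pad 1 X = pad 1 Y * T"
    unfolding eq[symmetric] assoc_mult_mat[OF mult_carrier_mat[OF P(2) pX] Q(2) T(2)] T(3)
    using right_mult_one_mat[OF mult_carrier_mat[OF P(2) pX]] by simp
  obtain S where S: "regular_at S x" "S \<in> carrier_mat (k + 1) (k + 1)" "P * S = 1\<^sub>m (k + 1)"
      "S * P = 1\<^sub>m (k + 1)"
    using regular_at_inverse[OF P] by metis
  have pfP: "pole_free P x" and pfS: "pole_free S x"
    using P S by (simp_all add: regular_at_iff)
  show ?thesis
  proof (cases "rat_eval (S $$ (k, k)) x = 0")
    case False
    thus ?thesis using equivalent_at_cancel_1_aux[OF XY P T(1,2) PT S(2,4)] by blast
  next
    case True
    \<comment> \<open>With this sign, the last row of \<open>E'\<close>, the inverse of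
      \<open>E\<close>, is that of \<open>P\<close> with the corner replaced by 1. The corner of
      \<open>E' * S\<close> therefore differs from the corner of \<open>P * S\<close>, which is 1,
      only in the last summand.\<close>
    define U where "U = mat 1 k (\<lambda>(i, j). - P $$ (k, j))"
    define E where "E = four_block_mat (1\<^sub>m k) (0\<^sub>m k 1) U (1\<^sub>m 1)"
    define E' where "E' = four_block_mat (1\<^sub>m k) (0\<^sub>m k 1) (- U) (1\<^sub>m 1)"
    define F where "F = four_block_mat (1\<^sub>m m) (0\<^sub>m m 1) (U * X) (1\<^sub>m 1)"
    have U: "U \<in> carrier_mat 1 k" by (simp add: U_def)
    have pfU: "pole_free U x"
      using pfP P(2) by (auto simp: pole_free_def U_def intro!: not_has_pole_uminus)
    have pfUX: "pole_free (U * X) x" using pfU X U XY(1) by (intro pole_free_mult) auto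
    have E: "regular_at E x" "E \<in> carrier_mat (k + 1) (k + 1)"
      unfolding E_def using regular_at_lower_elementary[OF U pfU] U by auto
    have F: "regular_at F x" "F \<in> carrier_mat (m + 1) (m + 1)"
      unfolding F_def using regular_at_lower_elementary[of "U * X" m x] pfUX U XY(1) by auto
    have E': "E' \<in> carrier_mat (k + 1) (k + 1)" unfolding E'_def using U by auto
    have EE: "E' * E = 1\<^sub>m (k + 1)"
    proof -
      have "E' * E = four_block_mat (1\<^sub>m k) (0\<^sub>m k 1) (- U + U) (1\<^sub>m 1)"
        unfolding E_def E'_def using U
        by (subst mult_four_block_mat[of _ k k _ 1 _ 1 _ _ k _ 1]) auto
      also have "- U + U = 0\<^sub>m 1 k" using U by auto
      finally show ?thesis by simp
    qed
    have eq': "P * E * pad 1 X = pad 1 Y * (T * F)"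
    proof -
      have "E * pad 1 X = pad 1 X * F"
        unfolding E_def F_def by (rule pad_mult_elementary[OF XY(1) U])
      hence "P * E * pad 1 X = P * (pad 1 X * F)"
        unfolding assoc_mult_mat[OF P(2) E(2) pX] by simp
      also have "\<dots> = pad 1 Y * T * F"
        unfolding assoc_mult_mat[OF P(2) pX F(2), symmetric] PT ..
      also have "\<dots> = pad 1 Y * (T * F)"
        by (rule assoc_mult_mat[OF pY T(2) F(2)])
      finally show ?thesis .
    qed
    have inv: "E' * S * (P * E) = 1\<^sub>m (k + 1)"
    proof -
      have "E' * S * (P * E) = E' * (S * P * E)"
        unfolding assoc_mult_mat[OF E' S(2) mult_carrier_mat[OF P(2) E(2)]]
          assoc_mult_mat[OF S(2) P(2) E(2)] ..
      thus ?thesis using S(4) E(2) EE by simp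
    qed
    have ES: "(E' * S) $$ (k, k) = S $$ (k, k) + (\<Sum>j = 0..<k. P $$ (k, j) * S $$ (j, k))"
    proof -
      have "(E' * S) $$ (k, k) = (\<Sum>j = 0..<Suc k. E' $$ (k, j) * S $$ (j, k))"
        using E' S(2) by (simp add: scalar_prod_def)
      also have "\<dots> = (\<Sum>j = 0..<k. E' $$ (k, j) * S $$ (j, k)) + E' $$ (k, k) * S $$ (k, k)"
        by simp
      also have "(\<Sum>j = 0..<k. E' $$ (k, j) * S $$ (j, k)) = (\<Sum>j = 0..<k. P $$ (k, j) * S $$ (j, k))"
        by (intro sum.cong) (auto simp: E'_def U_def)
      also have "E' $$ (k, k) = 1" by (simp add: E'_def U_def)
      finally show ?thesis by (simp add: add.commute)
    qed
    have "(P * S) $$ (k, k) = (\<Sum>j = 0..<Suc k. P $$ (k, j) * S $$ (j, k))"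
      using P(2) S(2) by (simp add: scalar_prod_def)
    hence PS: "(\<Sum>j = 0..<k. P $$ (k, j) * S $$ (j, k)) + P $$ (k, k) * S $$ (k, k) = 1"
      using S(3) by simp
    have val: "(E' * S) $$ (k, k) = 1 + (1 + - P $$ (k, k)) * S $$ (k, k)"
      unfolding ES using PS by (simp add: algebra_simps eq_diff_eq)
    have "\<not> has_pole (P $$ (k, k)) x" and np1: "\<not> has_pole (S $$ (k, k)) x"
      using pfS S(2) pfP P(2) by (auto simp: pole_free_def)
    hence np2: "\<not> has_pole (1 + - P $$ (k, k)) x"
      by (intro not_has_pole_add not_has_pole_uminus not_has_pole_1)
    \<comment> \<open>The old corner entry has value 0 in this case, so the new one has value
      1.\<close>
    have "rat_eval ((E' * S) $$ (k, k)) x =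
        1 + rat_eval (1 + - P $$ (k, k)) x * rat_eval (S $$ (k, k)) x"
      unfolding val rat_eval_add[OF not_has_pole_1 not_has_pole_mult[OF np2 np1]]
        rat_eval_mult[OF np2 np1] rat_eval_1 ..
    hence "rat_eval ((E' * S) $$ (k, k)) x \<noteq> 0" unfolding True by simp
    thus ?thesis
      by (rule equivalent_at_cancel_1_aux[OF XY regular_at_mult[OF P(1) E(1) P(2) E(2)]
            mult_carrier_mat[OF P(2) E(2)] regular_at_mult[OF T(1) F(1) T(2) F(2)]
            mult_carrier_mat[OF T(2) F(2)] eq' mult_carrier_mat[OF E' S(2)] inv])
  qed
qed

lemma equivalent_at_cancel:
  assumes "pole_free X x" "equivalent_at x (pad s X) (pad s Y)"
  shows "equivalent_at x X Y"
  using assms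
proof (induction s)
  case (Suc s)
  have "equivalent_at x (pad 1 (pad s X)) (pad 1 (pad s Y))"
    using Suc.prems(2) by (simp add: pad_pad)
  moreover have "pole_free (pad s X) x" using Suc.prems(1) pole_free_pad_iff by blast
  ultimately have "equivalent_at x (pad s X) (pad s Y)" by (rule equivalent_at_cancel_1[rotated])
  thus ?case by (rule Suc.IH[OF Suc.prems(1)])
qed simp

section \<open>Degrees and polynomial parts\<close>

lemma mat_degree_le_iff:
  "mat_degree M \<le> d \<longleftrightarrow> (\<forall>i<dim_row M. \<forall>j<dim_col M. degree (M $$ (i, j)) \<le> d)"
proof -
  have "finite (insert 0 (degree ` elements_mat M))" by (simp add: elements_mat_def)
  hence "mat_degree M \<le> d \<longleftrightarrow> (\<forall>a \<in> elements_mat M. degree a \<le> d)"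
    unfolding mat_degree_def by (subst Max_le_iff) auto
  thus ?thesis by (fastforce dest: elements_matD)
qed

lemma degree_le_mat_degree:
  "i < dim_row M \<Longrightarrow> j < dim_col M \<Longrightarrow> degree (M $$ (i, j)) \<le> mat_degree M"
  using mat_degree_le_iff[of M "mat_degree M"] by simp

lemma strictly_proper_0 [simp]: "strictly_proper 0"
  unfolding strictly_proper_def by (intro exI[of _ 0] exI[of _ 1]) (simp add: fract_collapse)

lemma polynomial_part_eqI:
  assumes "Q \<in> carrier_mat (dim_row G) (dim_col G)" "S \<in> carrier_mat (dim_row G) (dim_col G)"
    "strictly_proper_mat S" "G = map_mat to_fract Q + S"
  shows "polynomial_part G = Q"
  unfolding polynomial_part_def
  by (rule the1_equality[OF polynomial_part_unique_existence]) (use assms in blast)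

text \<open>Both branches of \<open>natural_grade\<close> agree with this formula: for a strictly
  proper matrix, uniqueness of the decomposition forces \<open>Q\<close> to be zero, and the zero
  matrix has degree 0.\<close>

lemma natural_grade_eq_mat_degree:
  assumes "Q \<in> carrier_mat (dim_row G) (dim_col G)" "S \<in> carrier_mat (dim_row G) (dim_col G)"
    "strictly_proper_mat S" "G = map_mat to_fract Q + S"
  shows "natural_grade G = mat_degree Q"
proof (cases "strictly_proper_mat G")
  case True
  have "polynomial_part G = 0\<^sub>m (dim_row G) (dim_col G)"
    by (rule polynomial_part_eqI[where S = G]) (use True in auto)
  hence "Q = 0\<^sub>m (dim_row G) (dim_col G)" using polynomial_part_eqI[OF assms] by simp
  hence "mat_degree Q \<le> 0" unfolding mat_degree_le_iff by simp
  thus ?thesis using True by (simp add: natural_grade_def)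
next
  case False
  thus ?thesis using polynomial_part_eqI[OF assms] by (simp add: natural_grade_def)
qed

section \<open>Inverses and the adjugate formula for the transfer function\<close>

lemma the_mat_inverse_eqI:
  fixes A :: "'a::field mat"
  assumes A: "A \<in> carrier_mat n n" and A': "A' \<in> carrier_mat n n" "A * A' = 1\<^sub>m n"
  shows "the (mat_inverse A) = A'"
proof -
  have "det A * det A' = 1" using det_mult[OF A A'(1)] A'(2) by simp
  hence "det A \<noteq> 0" by auto
  \<comment> \<open>The dummy \<open>()\<close> fills a free parameter of the matrix ring, so that
    both facts speak of the same ring.\<close>
  hence "mat_inverse A \<noteq> None"
    using mat_inverse(1)[OF A, of "()"] det_non_zero_imp_unit[OF A, of "()"] by blast
  then obtain B where B: "mat_inverse A = Some B" by blast
  have B': "B * A = 1\<^sub>m n" "B \<in> carrier_mat n n" using mat_inverse(2)[OF A B] by auto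
  have "B = B * (A * A')" using A' B' by simp
  also have "\<dots> = A'" using assoc_mult_mat[OF B'(2) A A'(1)] B'(1) A'(1) by simp
  finally show ?thesis using B by simp
qed

lemma comm_ring_hom_to_fract: "comm_ring_hom (to_fract :: 'a::idom \<Rightarrow> 'a fract)"
  by unfold_locales simp_all

lemma comm_ring_hom_poly: "comm_ring_hom (\<lambda>p :: 'a::comm_ring_1 poly. poly p x)"
  by unfold_locales simp_all

lemma comm_ring_hom_pCons: "comm_ring_hom (\<lambda>c :: 'a::comm_ring_1. [:c:])"
  by unfold_locales (simp_all add: one_pCons)

text \<open>Replacing the inverse by the adjugate over the determinant leaves one polynomial matrix
  over a common denominator.\<close>

lemma transfer_function_adj:
  fixes A :: "'a::field poly mat"
  assumes A: "A \<in> carrier_mat n n" and B: "B \<in> carrier_mat n r" and C: "C \<in> carrier_mat q n"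
    and d: "det A \<noteq> 0"
  shows "transfer_function (PSM A B C D) =
    map_mat to_fract D + inverse (to_fract (det A)) \<cdot>\<^sub>m map_mat to_fract (C * adj_mat A * B)"
proof -
  interpret h: comm_ring_hom "to_fract :: 'a poly \<Rightarrow> _" by (rule comm_ring_hom_to_fract)
  let ?h = "map_mat to_fract :: 'a poly mat \<Rightarrow> _" and ?d = "to_fract (det A)"
  note adj = adj_mat[OF A]
  have adjh: "?h (adj_mat A) \<in> carrier_mat n n" using adj(1) by simp
  have dh: "?d \<noteq> 0" using d by simp
  have "?h A * (inverse ?d \<cdot>\<^sub>m ?h (adj_mat A)) = inverse ?d \<cdot>\<^sub>m ?h (A * adj_mat A)"
    using A adj(1) mult_smult_distrib[of "?h A" n n "?h (adj_mat A)" n] h.mat_hom_mult[OF A adj(1)]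
    by simp
  also have "\<dots> = 1\<^sub>m n" unfolding adj(2) using dh by (intro eq_matI) auto
  finally have "the (mat_inverse (?h A)) = inverse ?d \<cdot>\<^sub>m ?h (adj_mat A)"
    using A adj(1) by (intro the_mat_inverse_eqI) auto
  hence "transfer_function (PSM A B C D) =
      ?h D + ?h C * (inverse ?d \<cdot>\<^sub>m ?h (adj_mat A)) * ?h B"
    by (simp add: transfer_function_def)
  also have "?h C * (inverse ?d \<cdot>\<^sub>m ?h (adj_mat A)) = inverse ?d \<cdot>\<^sub>m ?h (C * adj_mat A)"
    using C adj(1) by (simp add: mult_smult_distrib[of _ q n _ n] h.mat_hom_mult[OF C adj(1)])
  also have "\<dots> * ?h B = inverse ?d \<cdot>\<^sub>m ?h (C * adj_mat A * B)"
    unfolding h.mat_hom_mult[OF mult_carrier_mat[OF C adj(1)] B]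
    by (rule mult_smult_assoc_mat[of _ q n _ r]) (use B C adj(1) in auto)
  finally show ?thesis .
qed

section \<open>Linear pencils\<close>

abbreviation const_mat :: "'a::zero mat \<Rightarrow> 'a poly mat" where
  "const_mat M \<equiv> map_mat (\<lambda>c. [:c:]) M"

lemma pencil_carrier [simp]: "M0 \<in> carrier_mat k m \<Longrightarrow> pencil M1 M0 \<in> carrier_mat k m"
  unfolding pencil_def by simp

lemma index_pencil:
  assumes "M1 \<in> carrier_mat k m" "M0 \<in> carrier_mat k m" "i < k" "j < m"
  shows "pencil M1 M0 $$ (i, j) = [:M0 $$ (i, j), M1 $$ (i, j):]"
  using assms by (simp add: pencil_def)

lemma const_mat_mult:
  fixes M :: "'a::comm_ring_1 mat"
  assumes "M \<in> carrier_mat k m" "N \<in> carrier_mat m l"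
  shows "const_mat (M * N) = const_mat M * const_mat N"
proof -
  interpret comm_ring_hom "\<lambda>c :: 'a. [:c:]" by (rule comm_ring_hom_pCons)
  show ?thesis by (rule mat_hom_mult[OF assms])
qed

lemma const_mat_mult_pencil:
  assumes "K \<in> carrier_mat k n" "M1 \<in> carrier_mat n m" "M0 \<in> carrier_mat n m"
  shows "const_mat K * pencil M1 M0 = pencil (K * M1) (K * M0)"
proof -
  have "const_mat K * pencil M1 M0 =
      const_mat K * ([:0, 1:] \<cdot>\<^sub>m const_mat M1) + const_mat K * const_mat M0"
    unfolding pencil_def by (rule mult_add_distrib_mat[of _ k n]) (use assms in auto)
  thus ?thesis using assms
    by (simp add: pencil_def const_mat_mult[OF assms(1,2)] const_mat_mult[OF assms(1,3)]
        mult_smult_distrib[of _ k n _ m])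
qed

lemma pencil_mult_const_mat:
  assumes "M1 \<in> carrier_mat k n" "M0 \<in> carrier_mat k n" "J \<in> carrier_mat n m"
  shows "pencil M1 M0 * const_mat J = pencil (M1 * J) (M0 * J)"
proof -
  have "pencil M1 M0 * const_mat J =
      ([:0, 1:] \<cdot>\<^sub>m const_mat M1) * const_mat J + const_mat M0 * const_mat J"
    unfolding pencil_def by (rule add_mult_distrib_mat[of _ k n]) (use assms in auto)
  thus ?thesis using assms
    by (simp add: pencil_def const_mat_mult[OF assms(1,3)] const_mat_mult[OF assms(2,3)]
        mult_smult_assoc_mat[of _ k n _ m])
qed

lemma pencil_add_const_mat:
  assumes "M1 \<in> carrier_mat k m" "M0 \<in> carrier_mat k m" "N \<in> carrier_mat k m"
  shows "pencil M1 M0 + const_mat N = pencil M1 (M0 + N)"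
  using assms by (intro eq_matI) (auto simp: pencil_def)

lemma pencil_add:
  assumes "M1 \<in> carrier_mat k m" "M0 \<in> carrier_mat k m" "N1 \<in> carrier_mat k m"
    "N0 \<in> carrier_mat k m"
  shows "pencil M1 M0 + pencil N1 N0 = pencil (M1 + N1) (M0 + N0)"
  using assms by (intro eq_matI) (auto simp: pencil_def)

lemma mat_degree_pencil:
  assumes "M1 \<in> carrier_mat k m" "M0 \<in> carrier_mat k m"
  shows "mat_degree (pencil M1 M0) = (if M1 = 0\<^sub>m k m then 0 else 1)"
proof (cases "M1 = 0\<^sub>m k m")
  case True
  have "degree (pencil M1 M0 $$ (i, j)) = 0" if "i < k" "j < m" for i j
    unfolding index_pencil[OF assms that] using True that by simp
  hence "mat_degree (pencil M1 M0) \<le> 0"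
    unfolding mat_degree_le_iff using pencil_carrier[OF assms(2), of M1] by auto
  thus ?thesis using True by simp
next
  case False
  then obtain i j where ij: "i < k" "j < m" "M1 $$ (i, j) \<noteq> 0"
    using assms by (metis eq_matI carrier_matD index_zero_mat)
  hence "1 \<le> mat_degree (pencil M1 M0)"
    using degree_le_mat_degree[of i "pencil M1 M0" j] assms
      carrier_matD[OF pencil_carrier[OF assms(2), of M1]] by (auto simp: index_pencil[OF assms])
  moreover have "mat_degree (pencil M1 M0) \<le> 1"
    unfolding mat_degree_le_iff using carrier_matD[OF pencil_carrier[OF assms(2), of M1]]
    by (auto simp: index_pencil[OF assms])
  ultimately show ?thesis using False by simp
qed

lemma det_const_mat: "det (const_mat (M :: 'a::comm_ring_1 mat)) = [:det M:]"
  by (rule comm_ring_hom.hom_det[OF comm_ring_hom_pCons])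

text \<open>Factoring out the invertible \<open>A1\<close> leaves the characteristic matrix of
  \<open>- (A' * A0)\<close>, whose determinant is monic of degree \<open>n\<close>.\<close>

lemma degree_det_pencil:
  fixes A1 :: "'a::field mat"
  assumes A1: "A1 \<in> carrier_mat n n" and A0: "A0 \<in> carrier_mat n n"
    and A': "A' \<in> carrier_mat n n" "A1 * A' = 1\<^sub>m n"
  shows "degree (det (pencil A1 A0)) = n" "det (pencil A1 A0) \<noteq> 0"
proof -
  have AA: "A' * A0 \<in> carrier_mat n n" using A0 A' by simp
  have X: "- (A' * A0) \<in> carrier_mat n n" using A0 A' by simp
  have "char_poly_matrix (- (A' * A0)) = pencil (1\<^sub>m n) (A' * A0)"
    using carrier_matD[OF AA] carrier_matD[OF A0] carrier_matD[OF A'(1)]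
    by (intro eq_matI) (auto simp: char_poly_matrix_def pencil_def one_mat_def)
  hence "pencil A1 A0 = const_mat A1 * char_poly_matrix (- (A' * A0))"
    using const_mat_mult_pencil[OF A1 one_carrier_mat AA] A1 A0 A'
      assoc_mult_mat[OF A1 A'(1) A0] by simp
  hence det: "det (pencil A1 A0) = [:det A1:] * char_poly (- (A' * A0))"
    using A1 X by (simp add: det_mult[of _ n] det_const_mat char_poly_def)
  have "det A1 * det A' = 1" using det_mult[OF A1 A'(1)] A'(2) by simp
  hence "det A1 \<noteq> 0" by auto
  thus "degree (det (pencil A1 A0)) = n" "det (pencil A1 A0) \<noteq> 0"
    unfolding det using degree_monic_char_poly[OF X] by auto
qed

text \<open>Each cofactor is, up to sign, a determinant of order \<open>n - 1\<close> with entries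
  of degree at most 1.\<close>

lemma degree_adj_mat:
  assumes A: "A \<in> carrier_mat n n" and deg: "mat_degree A \<le> 1" and ij: "i < n" "j < n"
  shows "degree (adj_mat A $$ (i, j)) \<le> n - 1"
proof -
  have "degree (mat_delete A j i $$ (k, l)) \<le> 1" if "k < n - 1" "l < n - 1" for k l
    using that A ij deg[unfolded mat_degree_le_iff] by (auto simp: mat_delete_def)
  hence d: "degree (det (mat_delete A j i)) \<le> n - 1"
    using degree_det_le[of "n - 1" "mat_delete A j i" 1] mat_delete_carrier[OF A] by simp
  have "degree ((-1 :: 'a poly) ^ k) = 0" for k
    by (cases "even k") simp_all
  hence "degree (cofactor A j i) \<le> n - 1"
    unfolding cofactor_def using degree_mult_le[of "(-1) ^ (j + i)" "det (mat_delete A j i)"] d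
    by simp
  thus ?thesis using A ij by (simp add: adj_mat_def)
qed

lemma degree_const_mat_mult:
  assumes "K \<in> carrier_mat k n" "W \<in> carrier_mat n m"
    and "\<And>i j. i < n \<Longrightarrow> j < m \<Longrightarrow> degree (W $$ (i, j)) \<le> d" "i < k" "j < m"
  shows "degree ((const_mat K * W) $$ (i, j)) \<le> d"
proof -
  have "degree ([:K $$ (i, l):] * W $$ (l, j)) \<le> d" if "l < n" for l
    using degree_mult_le[of "[:K $$ (i, l):]" "W $$ (l, j)"] assms(3)[OF that assms(5)] by simp
  thus ?thesis using assms by (auto simp: scalar_prod_def intro!: degree_sum_le)
qed

lemma degree_mult_const_mat:
  assumes "W \<in> carrier_mat k n" "K \<in> carrier_mat n m"
    and "\<And>i j. i < k \<Longrightarrow> j < n \<Longrightarrow> degree (W $$ (i, j)) \<le> d" "i < k" "j < m"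
  shows "degree ((W * const_mat K) $$ (i, j)) \<le> d"
proof -
  have "degree (W $$ (i, l) * [:K $$ (l, j):]) \<le> d" if "l < n" for l
    using degree_mult_le[of "W $$ (i, l)" "[:K $$ (l, j):]"] assms(3)[OF assms(4) that] by simp
  thus ?thesis using assms by (auto simp: scalar_prod_def intro!: degree_sum_le)
qed

text \<open>Division with remainder by the state matrix from both sides,
  \<open>C = K A + E\<close> and \<open>B = A J + F\<close> with constant \<open>K\<close>, \<open>E\<close>, \<open>J\<close>, \<open>F\<close>, splits off the polynomial
  part of \<open>C A\<^sup>-\<^sup>1 B\<close>; the remaining part is \<open>E A\<^sup>-\<^sup>1 F\<close>.\<close>

lemma transfer_function_pencil:
  fixes A1 A0 B1 B0 C1 C0 D1 D0 A' :: "'a::field mat"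
  assumes n: "0 < n"
    and A1: "A1 \<in> carrier_mat n n" and A0: "A0 \<in> carrier_mat n n"
    and B1: "B1 \<in> carrier_mat n r" and B0: "B0 \<in> carrier_mat n r"
    and C1: "C1 \<in> carrier_mat q n" and C0: "C0 \<in> carrier_mat q n"
    and D1: "D1 \<in> carrier_mat q r" and D0: "D0 \<in> carrier_mat q r"
    and A': "A' \<in> carrier_mat n n" "A1 * A' = 1\<^sub>m n" "A' * A1 = 1\<^sub>m n"
  obtains N W where "N \<in> carrier_mat q r" "W \<in> carrier_mat q r"
    "\<And>i j. i < q \<Longrightarrow> j < r \<Longrightarrow> degree (W $$ (i, j)) < degree (det (pencil A1 A0))"
    "transfer_function (PSM (pencil A1 A0) (pencil B1 B0) (pencil C1 C0) (pencil D1 D0)) =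
       map_mat to_fract (pencil (D1 + C1 * A' * B1) N) +
       inverse (to_fract (det (pencil A1 A0))) \<cdot>\<^sub>m map_mat to_fract W"
proof
  define A B C where "A = pencil A1 A0" and "B = pencil B1 B0" and "C = pencil C1 C0"
  define d where "d = det A"
  have d0: "d \<noteq> 0" and degd: "degree d = n"
    using degree_det_pencil[OF A1 A0 A'(1,2)] by (simp_all add: d_def A_def)
  have A: "A \<in> carrier_mat n n" and B: "B \<in> carrier_mat n r" and C: "C \<in> carrier_mat q n"
    using A0 B0 C0 by (simp_all add: A_def B_def C_def)
  define K J where "K = C1 * A'" and "J = A' * B1"
  have K: "K \<in> carrier_mat q n" and J: "J \<in> carrier_mat n r"
    using C1 B1 A' by (simp_all add: K_def J_def)
  define E F where "E = C0 - K * A0" and "F = B0 - A0 * J"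
  have E: "E \<in> carrier_mat q n" and F: "F \<in> carrier_mat n r"
    using C0 B0 K J A0 by (auto simp: E_def F_def)
  have KA: "K * A1 = C1" unfolding K_def
    using assoc_mult_mat[OF C1 A'(1) A1] A'(3) C1 by simp
  have AJ: "A1 * J = B1" unfolding J_def
    using assoc_mult_mat[OF A1 A'(1) B1, symmetric] A'(2) B1 by simp
  have C_eq: "C = const_mat K * A + const_mat E"
    unfolding A_def const_mat_mult_pencil[OF K A1 A0] KA C_def
    using pencil_add_const_mat[OF C1 mult_carrier_mat[OF K A0] E] C0 K A0
    by (simp add: E_def) (intro arg_cong2[of _ _ _ _ pencil] eq_matI, auto)
  have B_eq: "B = A * const_mat J + const_mat F"
    unfolding A_def pencil_mult_const_mat[OF A1 A0 J] AJ B_def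
    using pencil_add_const_mat[OF B1 mult_carrier_mat[OF A0 J] F] B0 J A0
    by (simp add: F_def) (intro arg_cong2[of _ _ _ _ pencil] eq_matI, auto)
  define W where "W = const_mat E * adj_mat A * const_mat F"
  \<comment> \<open>The constant term of the polynomial part. The product of \<open>K\<close> with
    the pencil \<open>B\<close> gives \<open>K * B0\<close>, next to the leading term
    \<open>K * B1\<close>, and \<open>E * J\<close> comes from the quotient of
    \<open>B\<close>.\<close>
  define N where "N = D0 + (K * B0 + E * J)"
  note adj = adj_mat[OF A, folded d_def]
  let ?K = "const_mat K" and ?J = "const_mat J" and ?E = "const_mat E" and ?F = "const_mat F"
  have K': "?K \<in> carrier_mat q n" and J': "?J \<in> carrier_mat n r" and E': "?E \<in> carrier_mat q n"
    and F': "?F \<in> carrier_mat n r"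
    using K J E F by simp_all
  have EJ: "E * J \<in> carrier_mat q r" and KB: "K * B0 \<in> carrier_mat q r"
    and KB1: "K * B1 \<in> carrier_mat q r"
    using E J K B0 B1 by simp_all
  show N: "N \<in> carrier_mat q r" using D0 EJ KB by (simp add: N_def)
  show W: "W \<in> carrier_mat q r" using E' F' adj(1) by (simp add: W_def)
  \<comment> \<open>The adjugate turns the factors \<open>A\<close> in \<open>K A\<close> and
    \<open>A J\<close> into the scalar \<open>d\<close>, so only \<open>W\<close> is left
    undivided.\<close>
  have "C * adj_mat A = ?K * A * adj_mat A + ?E * adj_mat A"
    unfolding C_eq by (rule add_mult_distrib_mat[OF mult_carrier_mat[OF K' A] E' adj(1)])
  also have "?K * A * adj_mat A = d \<cdot>\<^sub>m ?K"
    unfolding assoc_mult_mat[OF K' A adj(1)] adj(2) mult_smult_distrib[OF K' one_carrier_mat]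
    using K' by simp
  finally have "C * adj_mat A * B = d \<cdot>\<^sub>m ?K * B + ?E * adj_mat A * B"
    using add_mult_distrib_mat[OF _ mult_carrier_mat[OF E' adj(1)] B, of "d \<cdot>\<^sub>m ?K"] K' by simp
  also have "d \<cdot>\<^sub>m ?K * B = d \<cdot>\<^sub>m (?K * B)" by (rule mult_smult_assoc_mat[OF K' B])
  also have "?E * adj_mat A * B = ?E * adj_mat A * (A * ?J) + W"
    unfolding B_eq W_def
    by (rule mult_add_distrib_mat[OF mult_carrier_mat[OF E' adj(1)] mult_carrier_mat[OF A J'] F'])
  also have "?E * adj_mat A * (A * ?J) = ?E * (adj_mat A * A * ?J)"
    unfolding assoc_mult_mat[OF E' adj(1) mult_carrier_mat[OF A J']] assoc_mult_mat[OF adj(1) A J'] ..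
  also have "\<dots> = d \<cdot>\<^sub>m (?E * ?J)"
    unfolding adj(3) mult_smult_assoc_mat[OF one_carrier_mat J'] left_mult_one_mat[OF J']
    by (rule mult_smult_distrib[OF E' J'])
  also have "?E * ?J = const_mat (E * J)" using const_mat_mult[OF E J] by simp
  also have "?K * B = pencil (K * B1) (K * B0)"
    unfolding B_def by (rule const_mat_mult_pencil[OF K B1 B0])
  finally have "C * adj_mat A * B =
      d \<cdot>\<^sub>m pencil (K * B1) (K * B0) + (d \<cdot>\<^sub>m const_mat (E * J) + W)" .
  also have "\<dots> = d \<cdot>\<^sub>m (pencil (K * B1) (K * B0) + const_mat (E * J)) + W"
  proof -
    have "d \<cdot>\<^sub>m X + (d \<cdot>\<^sub>m Y + W) = d \<cdot>\<^sub>m (X + Y) + W"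
      if "X \<in> carrier_mat q r" "Y \<in> carrier_mat q r" for X Y
      using that W by (intro eq_matI) (auto simp: algebra_simps)
    thus ?thesis using KB EJ by simp
  qed
  finally have CB: "C * adj_mat A * B = d \<cdot>\<^sub>m pencil (K * B1) (K * B0 + E * J) + W"
    unfolding pencil_add_const_mat[OF KB1 KB EJ] .
  have "transfer_function (PSM A B C (pencil D1 D0)) = map_mat to_fract (pencil D1 D0) +
      inverse (to_fract d) \<cdot>\<^sub>m map_mat to_fract (C * adj_mat A * B)"
    unfolding d_def by (rule transfer_function_adj[OF A B C d0[unfolded d_def]])
  also have "\<dots> = map_mat to_fract (pencil D1 D0 + pencil (K * B1) (K * B0 + E * J)) +
      inverse (to_fract d) \<cdot>\<^sub>m map_mat to_fract W"
  proof -
    have "pencil D1 D0 \<in> carrier_mat q r" "pencil (K * B1) (K * B0 + E * J) \<in> carrier_mat q r"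
      using D0 KB EJ by simp_all
    thus ?thesis unfolding CB using W d0 by (intro eq_matI) (auto simp: field_simps)
  qed
  also have "pencil D1 D0 + pencil (K * B1) (K * B0 + E * J) = pencil (D1 + K * B1) N"
    unfolding N_def by (rule pencil_add[OF D1 D0 KB1]) (use KB EJ in simp)
  finally show "transfer_function (PSM (pencil A1 A0) (pencil B1 B0) (pencil C1 C0) (pencil D1 D0)) =
       map_mat to_fract (pencil (D1 + C1 * A' * B1) N) +
       inverse (to_fract (det (pencil A1 A0))) \<cdot>\<^sub>m map_mat to_fract W"
    by (simp only: A_def B_def C_def d_def K_def)
  have "mat_degree A \<le> 1" unfolding A_def mat_degree_pencil[OF A1 A0] by simp
  \<comment> \<open>Constant factors do not raise the bound \<open>n - 1\<close>, which is below
    \<open>n\<close> because \<open>n\<close> is positive.\<close>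
  hence "degree (adj_mat A $$ (i, j)) \<le> n - 1" if "i < n" "j < n" for i j
    using degree_adj_mat[OF A] that by blast
  hence "degree ((?E * adj_mat A) $$ (i, j)) \<le> n - 1" if "i < q" "j < n" for i j
    using degree_const_mat_mult[OF E adj(1)] that by blast
  hence "degree (W $$ (i, j)) \<le> n - 1" if "i < q" "j < r" for i j
    unfolding W_def using degree_mult_const_mat[OF mult_carrier_mat[OF E' adj(1)] F] that by blast
  thus "degree (W $$ (i, j)) < degree (det (pencil A1 A0))" if "i < q" "j < r" for i j
    using that n degd unfolding d_def A_def by (metis Suc_pred' le_imp_less_Suc Suc_eq_plus1 One_nat_def)
qed

section \<open>Matrices of full rank\<close>

text \<open>The rank is the size of a maximal independent subset of the set of columns, and a
  repeated column makes this set have fewer than \<open>nc\<close> elements.\<close>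

lemma (in vec_space) full_column_rank_imp_distinct:
  assumes "A \<in> carrier_mat n nc" "rank A = nc"
  shows "distinct (cols A)"
proof (rule ccontr)
  assume nd: "\<not> distinct (cols A)"
  obtain S where S: "maximal S (\<lambda>T. T \<subseteq> set (cols A) \<and> lin_indpt T)"
    using maximal_exists[of "(\<lambda>T. T \<subseteq> set (cols A) \<and> lin_indpt T)" "card (set (cols A))" "{}"]
    by (meson List.finite_set card_mono empty_iff empty_subsetI finite_lin_indpt2 rev_finite_subset)
  hence "card S \<le> card (set (cols A))" by (simp add: card_mono maximal_def)
  also have "\<dots> < length (cols A)"
    using nd card_distinct card_length le_neq_implies_less by blast
  finally show False using rank_card_indpt[OF assms(1) S] assms by simp
qed

lemma (in vec_space) full_column_rank_imp_injective:
  assumes "A \<in> carrier_mat n nc" "rank A = nc" "v \<in> carrier_vec nc" "A *\<^sub>v v = 0\<^sub>v n"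
  shows "v = 0\<^sub>v nc"
  using full_column_rank_imp_distinct[OF assms(1,2)] full_rank_lin_indpt[OF assms(1,2)]
    lin_depI[OF assms(1,3) _ assms(4)] by blast

lemma mult_unit_vec_eq_col:
  fixes A :: "'a::semiring_1 mat"
  assumes "A \<in> carrier_mat k m" "j < m"
  shows "A *\<^sub>v unit_vec m j = col A j"
  using assms by (intro eq_vecI) auto

text \<open>Linear independence concerns the set of columns, so distinctness is shown first: two
  equal columns put a difference of unit vectors into the kernel.\<close>

lemma (in vec_space) injective_imp_full_column_rank:
  assumes A: "A \<in> carrier_mat n nc"
    and inj: "\<And>v. v \<in> carrier_vec nc \<Longrightarrow> A *\<^sub>v v = 0\<^sub>v n \<Longrightarrow> v = 0\<^sub>v nc"
  shows "rank A = nc"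
proof -
  have dist: "distinct (cols A)"
    unfolding distinct_conv_nth
  proof (intro allI impI)
    fix i j assume "i < length (cols A)" "j < length (cols A)" and ne: "i \<noteq> j"
    hence ij: "i < nc" "j < nc" using A by auto
    show "cols A ! i \<noteq> cols A ! j"
    proof
      assume "cols A ! i = cols A ! j"
      hence "A *\<^sub>v unit_vec nc i = A *\<^sub>v unit_vec nc j"
        using ij A by (simp add: mult_unit_vec_eq_col[OF A])
      hence "A *\<^sub>v (unit_vec nc i - unit_vec nc j) = 0\<^sub>v n"
        using A by (simp add: mult_minus_distrib_mat_vec[OF A])
      hence "unit_vec nc i - unit_vec nc j = (0\<^sub>v nc :: 'a vec)" by (intro inj) simp_all
      hence "(unit_vec nc i - unit_vec nc j :: 'a vec) $ i = 0" using ij by simp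
      thus False using ij ne by simp
    qed
  qed
  have "lin_indpt (set (cols A))" using lin_depE[OF A _ dist] inj by blast
  thus ?thesis using lin_indpt_full_rank[OF A dist] by blast
qed

text \<open>A maximal independent set of columns has \<open>n\<close> elements, hence is a basis of
  the whole space.\<close>

lemma (in vec_space) full_row_rank_imp_surjective:
  assumes A: "A \<in> carrier_mat n nc" and rank: "rank A = n" and y: "y \<in> carrier_vec n"
  shows "\<exists>v \<in> carrier_vec nc. A *\<^sub>v v = y"
proof -
  have sub: "set (cols A) \<subseteq> carrier_vec n" using cols_dim A by blast
  obtain S where S: "maximal S (\<lambda>T. T \<subseteq> set (cols A) \<and> lin_indpt T)"
    using maximal_exists[of "(\<lambda>T. T \<subseteq> set (cols A) \<and> lin_indpt T)" "card (set (cols A))" "{}"]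
    by (meson List.finite_set card_mono empty_iff empty_subsetI finite_lin_indpt2 rev_finite_subset)
  have card: "card S = n" using rank_card_indpt[OF A S] rank by simp
  have Ss: "S \<subseteq> set (cols A)" "lin_indpt S" using S unfolding maximal_def by auto
  have "basis S"
    using dim_li_is_basis[OF fin_dim] Ss sub card finite_subset[OF Ss(1)] dim_is_n by auto
  hence "span S = carrier_vec n" unfolding basis_def by auto
  hence "carrier_vec n \<subseteq> col_space A"
    unfolding col_space_def using span_is_monotone[OF Ss(1)] by simp
  thus ?thesis using y unfolding col_space_eq[OF A] using A by auto
qed

lemma (in vec_space) surjective_imp_full_row_rank:
  assumes A: "A \<in> carrier_mat n nc"
    and surj: "\<And>y. y \<in> carrier_vec n \<Longrightarrow> \<exists>v \<in> carrier_vec nc. A *\<^sub>v v = y"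
  shows "rank A = n"
proof -
  have "span (set (cols A)) = carrier_vec n"
    unfolding col_space_def[symmetric] col_space_eq[OF A] using A surj by auto
  hence "span_vs (set (cols A)) = V" by simp
  thus ?thesis unfolding rank_def using dim_is_n by simp
qed

lemma (in vec_space) full_row_rank_imp_right_inverse:
  assumes A: "A \<in> carrier_mat n nc" and rank: "rank A = n"
  obtains W where "W \<in> carrier_mat nc n" "A * W = 1\<^sub>m n"
proof -
  have "\<forall>j. \<exists>v \<in> carrier_vec nc. A *\<^sub>v v = unit_vec n j"
    using full_row_rank_imp_surjective[OF A rank] by simp
  then obtain w where w: "\<And>j. w j \<in> carrier_vec nc" "\<And>j. A *\<^sub>v w j = unit_vec n j" by metis
  define W where "W = mat nc n (\<lambda>(i, j). w j $ i)"
  have W: "W \<in> carrier_mat nc n" by (simp add: W_def)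
  have col: "col W j = w j" if "j < n" for j
    using that w(1)[of j] by (intro eq_vecI) (auto simp: W_def)
  have "A * W = 1\<^sub>m n"
  proof (rule eq_matI)
    fix i j assume "i < dim_row (1\<^sub>m n :: 'a mat)" "j < dim_col (1\<^sub>m n :: 'a mat)"
    hence ij: "i < n" "j < n" by auto
    have "(A * W) $$ (i, j) = (A *\<^sub>v w j) $ i" using ij A W col by simp
    thus "(A * W) $$ (i, j) = 1\<^sub>m n $$ (i, j)" unfolding w using ij by auto
  qed (use A W in auto)
  thus ?thesis using W that by blast
qed

section \<open>Full rank of stacked and juxtaposed blocks\<close>

lemma append_rows_mult_vec_eq_0_iff:
  fixes A :: "'a::field mat"
  assumes "A \<in> carrier_mat k n" "C \<in> carrier_mat q n" "v \<in> carrier_vec n"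
  shows "(A @\<^sub>r C) *\<^sub>v v = 0\<^sub>v (k + q) \<longleftrightarrow> A *\<^sub>v v = 0\<^sub>v k \<and> C *\<^sub>v v = 0\<^sub>v q"
proof -
  have z: "0\<^sub>v (k + q) = (0\<^sub>v k @\<^sub>v 0\<^sub>v q :: 'a vec)" by auto
  show ?thesis unfolding mat_mult_append[OF assms] z
    by (rule append_vec_eq[of _ k]) (use assms in auto)
qed

lemma append_cols_mult:
  assumes "A \<in> carrier_mat n k" "B \<in> carrier_mat n r" "W \<in> carrier_mat (k + r) m"
  obtains U V where "U \<in> carrier_mat k m" "V \<in> carrier_mat r m"
    "append_cols_mat A B * W = A * U + B * V"
proof -
  \<comment> \<open>Splitting at the last column gives right blocks without columns, so that the
    four-block product rule applies.\<close>
  obtain U V0 V V1 where s: "split_block W k m = (U, V0, V, V1)" by (metis prod_cases4)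
  note sb = split_block[OF s, of r 0]
  have U: "U \<in> carrier_mat k m" and V: "V \<in> carrier_mat r m" and V0: "V0 \<in> carrier_mat k 0"
    and V1: "V1 \<in> carrier_mat r 0" and W: "W = four_block_mat U V0 V V1"
    using sb assms(3) by auto
  have "append_cols_mat A B * W = four_block_mat (A * U + B * V) (A * V0 + B * V1)
      (0\<^sub>m 0 k * U + 0\<^sub>m 0 r * V) (0\<^sub>m 0 k * V0 + 0\<^sub>m 0 r * V1)"
    unfolding append_cols_mat_def W using assms U V V0 V1
    by (subst mult_four_block_mat[of _ n k _ r _ 0 _ _ m _ 0]) auto
  also have "\<dots> = A * U + B * V" using assms U V V0 V1 by (intro eq_matI) auto
  finally show ?thesis using that U V by blast
qed

lemma append_cols_mult_vec:
  fixes A :: "'a::field mat"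
  assumes "A \<in> carrier_mat n k" "B \<in> carrier_mat n r" "v \<in> carrier_vec k" "w \<in> carrier_vec r"
  shows "append_cols_mat A B *\<^sub>v (v @\<^sub>v w) = A *\<^sub>v v + B *\<^sub>v w"
  using assms unfolding append_cols_mat_def
  by (subst four_block_mat_mult_vec[of _ n k _ r _ 0]) auto

lemma mat_rank_append_rows_eqD:
  fixes A :: "'a::field mat"
  assumes "A \<in> carrier_mat k n" "C \<in> carrier_mat q n" "mat_rank (A @\<^sub>r C) = n"
    "v \<in> carrier_vec n" "A *\<^sub>v v = 0\<^sub>v k" "C *\<^sub>v v = 0\<^sub>v q"
  shows "v = 0\<^sub>v n"
  using vec_space.full_column_rank_imp_injective[OF carrier_append_rows[OF assms(1,2)] _ assms(4)]
    assms carrier_append_rows[OF assms(1,2)] append_rows_mult_vec_eq_0_iff[OF assms(1,2,4)]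
  by (simp add: mat_rank_def)

text \<open>Full row rank, put as a Bezout identity.\<close>

lemma mat_rank_append_cols_eqD:
  fixes A :: "'a::field mat"
  assumes "A \<in> carrier_mat n k" "B \<in> carrier_mat n r" "mat_rank (append_cols_mat A B) = n"
  obtains U V where "U \<in> carrier_mat k n" "V \<in> carrier_mat r n" "A * U + B * V = 1\<^sub>m n"
proof -
  have M: "append_cols_mat A B \<in> carrier_mat n (k + r)"
    using assms unfolding append_cols_mat_def by auto
  obtain W where W: "W \<in> carrier_mat (k + r) n" "append_cols_mat A B * W = 1\<^sub>m n"
    using vec_space.full_row_rank_imp_right_inverse[OF M] assms(3) M by (auto simp: mat_rank_def)
  show ?thesis using append_cols_mult[OF assms(1,2) W(1)] W(2) that by metis
qed

lemma mat_rank_append_rows_invertible: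
  fixes A :: "'a::field mat"
  assumes A: "A \<in> carrier_mat n n" and C: "C \<in> carrier_mat q n"
    and A': "A' \<in> carrier_mat n n" "A' * A = 1\<^sub>m n"
  shows "mat_rank (A @\<^sub>r C) = n"
proof -
  have M: "A @\<^sub>r C \<in> carrier_mat (n + q) n" using carrier_append_rows[OF A C] .
  have "v = 0\<^sub>v n" if v: "v \<in> carrier_vec n" "(A @\<^sub>r C) *\<^sub>v v = 0\<^sub>v (n + q)" for v
  proof -
    have "A *\<^sub>v v = 0\<^sub>v n" using v append_rows_mult_vec_eq_0_iff[OF A C v(1)] by blast
    hence "A' * A *\<^sub>v v = 0\<^sub>v n"
      using assoc_mult_mat_vec[OF A'(1) A v(1)] mult_mat_vec_carrier[OF A'(1)] A'(1) by auto
    thus ?thesis unfolding A'(2) using v by simp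
  qed
  thus ?thesis
    using vec_space.injective_imp_full_column_rank[OF M] M by (simp add: mat_rank_def)
qed

lemma mat_rank_append_cols_invertible:
  fixes A :: "'a::field mat"
  assumes A: "A \<in> carrier_mat n n" and B: "B \<in> carrier_mat n r"
    and A': "A' \<in> carrier_mat n n" "A * A' = 1\<^sub>m n"
  shows "mat_rank (append_cols_mat A B) = n"
proof -
  have M: "append_cols_mat A B \<in> carrier_mat n (n + r)"
    using A B unfolding append_cols_mat_def by auto
  have "\<exists>v \<in> carrier_vec (n + r). append_cols_mat A B *\<^sub>v v = y" if y: "y \<in> carrier_vec n" for y
  proof (intro bexI)
    have A'y: "A' *\<^sub>v y \<in> carrier_vec n" using A'(1) y by simp
    have "A *\<^sub>v (A' *\<^sub>v y) = y"
      using assoc_mult_mat_vec[OF A A'(1) y] A'(2) y by simp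
    moreover have "B *\<^sub>v 0\<^sub>v r = 0\<^sub>v n" using B by auto
    ultimately show "append_cols_mat A B *\<^sub>v (A' *\<^sub>v y @\<^sub>v 0\<^sub>v r) = y"
      using append_cols_mult_vec[OF A B A'y zero_carrier_vec] y by simp
    show "A' *\<^sub>v y @\<^sub>v 0\<^sub>v r \<in> carrier_vec (n + r)" using A'y by simp
  qed
  thus ?thesis
    using vec_space.surjective_imp_full_row_rank[OF M] M by (simp add: mat_rank_def)
qed

section \<open>Minimality of system matrices\<close>

lemma smult_mat_cancel:
  fixes c :: "'a::idom"
  assumes "c \<cdot>\<^sub>m M = c \<cdot>\<^sub>m N" "c \<noteq> 0"
  shows "M = N"
proof (rule eq_matI)
  have "dim_row (c \<cdot>\<^sub>m M) = dim_row (c \<cdot>\<^sub>m N)" "dim_col (c \<cdot>\<^sub>m M) = dim_col (c \<cdot>\<^sub>m N)"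
    unfolding assms(1) by simp_all
  thus dims: "dim_row M = dim_row N" "dim_col M = dim_col N" by simp_all
  fix i j assume ij: "i < dim_row N" "j < dim_col N"
  have "(c \<cdot>\<^sub>m M) $$ (i, j) = (c \<cdot>\<^sub>m N) $$ (i, j)" unfolding assms(1) ..
  thus "M $$ (i, j) = N $$ (i, j)" using ij dims assms(2) by simp
qed

lemma eval_mat_mult:
  fixes A :: "'a::field poly mat"
  assumes "A \<in> carrier_mat k n" "B \<in> carrier_mat n m"
  shows "eval_mat (A * B) x = eval_mat A x * eval_mat B x"
  by (rule semiring_hom.mat_hom_mult[OF _ assms]) (unfold_locales, simp_all)

lemma mat_eq_0_if_mult_cols_eq_0:
  fixes Z :: "'a::field mat"
  assumes A: "A \<in> carrier_mat k n" and C: "C \<in> carrier_mat q n" and Z: "Z \<in> carrier_mat n r"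
    and inj: "\<And>v. v \<in> carrier_vec n \<Longrightarrow> A *\<^sub>v v = 0\<^sub>v k \<Longrightarrow> C *\<^sub>v v = 0\<^sub>v q \<Longrightarrow> v = 0\<^sub>v n"
    and AZ: "A * Z = 0\<^sub>m k r" and CZ: "C * Z = 0\<^sub>m q r"
  shows "Z = 0\<^sub>m n r"
proof (rule eq_matI)
  fix i j assume "i < dim_row (0\<^sub>m n r :: 'a mat)" "j < dim_col (0\<^sub>m n r :: 'a mat)"
  hence ij: "i < n" "j < r" by auto
  have "A *\<^sub>v col Z j = col (A * Z) j" "C *\<^sub>v col Z j = col (C * Z) j"
    using col_mult2[OF A Z ij(2)] col_mult2[OF C Z ij(2)] by simp_all
  hence "col Z j = 0\<^sub>v n" unfolding AZ CZ using ij Z by (intro inj) auto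
  hence "col Z j $ i = 0" using ij by simp
  thus "Z $$ (i, j) = 0\<^sub>m n r $$ (i, j)" using ij Z by simp
qed (use Z in auto)

text \<open>At a root \<open>x\<close> of \<open>f\<close> both \<open>A\<close> and
  \<open>C\<close> annihilate the columns of \<open>W\<close> evaluated at \<open>x\<close>, so
  these vanish and a linear factor cancels from \<open>W\<close> and \<open>f\<close>. Induction on
  the degree of \<open>f\<close> removes all such factors; the equation for \<open>C\<close> is
  carried along to feed the next step.\<close>

lemma divide_out_root:
  fixes A C W B E :: "'a::field poly mat"
  assumes A: "A \<in> carrier_mat k n" and C: "C \<in> carrier_mat q n"
    and B: "B \<in> carrier_mat k r" and E: "E \<in> carrier_mat q r"
    and inj: "\<And>v. v \<in> carrier_vec n \<Longrightarrow> eval_mat A x *\<^sub>v v = 0\<^sub>v k \<Longrightarrow>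
      eval_mat C x *\<^sub>v v = 0\<^sub>v q \<Longrightarrow> v = 0\<^sub>v n"
    and W: "W \<in> carrier_mat n r" and f: "f \<noteq> 0"
    and AW: "A * W = f \<cdot>\<^sub>m B" and CW: "C * W = f \<cdot>\<^sub>m E"
  shows "\<exists>h W'. poly h x \<noteq> 0 \<and> W' \<in> carrier_mat n r \<and> A * W' = h \<cdot>\<^sub>m B"
  using W f AW CW
proof (induction "degree f" arbitrary: f W rule: less_induct)
  case less
  show ?case
  proof (cases "poly f x = 0")
    case False
    thus ?thesis using less.prems by blast
  next
    case True
    let ?t = "[:-x, 1:]"
    obtain f' where f': "f = ?t * f'" using True by (auto simp: poly_eq_0_iff_dvd)
    have f'0: "f' \<noteq> 0" using f' less.prems by auto
    have deg: "degree f' < degree f" unfolding f' using f'0 by (subst degree_mult_eq) auto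
    have "eval_mat A x * eval_mat W x = eval_mat (f \<cdot>\<^sub>m B) x"
      unfolding less.prems(3)[symmetric] eval_mat_mult[OF A less.prems(1)] ..
    also have "\<dots> = 0\<^sub>m k r" using True B by (intro eq_matI) auto
    finally have Z1: "eval_mat A x * eval_mat W x = 0\<^sub>m k r" .
    have "eval_mat C x * eval_mat W x = eval_mat (f \<cdot>\<^sub>m E) x"
      unfolding less.prems(4)[symmetric] eval_mat_mult[OF C less.prems(1)] ..
    also have "\<dots> = 0\<^sub>m q r" using True E by (intro eq_matI) auto
    finally have Z2: "eval_mat C x * eval_mat W x = 0\<^sub>m q r" .
    have Z: "eval_mat W x = 0\<^sub>m n r"
      by (rule mat_eq_0_if_mult_cols_eq_0[OF _ _ _ inj Z1 Z2]) (use A C less.prems in auto)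
    define W' where "W' = map_mat (\<lambda>p. p div ?t) W"
    have W': "W' \<in> carrier_mat n r" using less.prems by (simp add: W'_def)
    have "W = ?t \<cdot>\<^sub>m W'"
    proof (rule eq_matI)
      fix i j assume "i < dim_row (?t \<cdot>\<^sub>m W')" "j < dim_col (?t \<cdot>\<^sub>m W')"
      hence ij: "i < n" "j < r" using W' by auto
      have "eval_mat W x $$ (i, j) = 0" unfolding Z using ij by simp
      hence "?t dvd W $$ (i, j)" using ij less.prems by (simp add: poly_eq_0_iff_dvd)
      hence "?t * (W $$ (i, j) div ?t) = W $$ (i, j)" by (rule dvd_mult_div_cancel)
      thus "W $$ (i, j) = (?t \<cdot>\<^sub>m W') $$ (i, j)"
        using ij less.prems by (simp add: W'_def del: mult_pCons_left)
    qed (use W' less.prems in auto)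
    moreover have "f \<cdot>\<^sub>m M = ?t \<cdot>\<^sub>m (f' \<cdot>\<^sub>m M)" for M
      unfolding f' by (intro eq_matI) (simp_all add: mult.assoc del: mult_pCons_left)
    ultimately have "?t \<cdot>\<^sub>m (A * W') = ?t \<cdot>\<^sub>m (f' \<cdot>\<^sub>m B)" "?t \<cdot>\<^sub>m (C * W') = ?t \<cdot>\<^sub>m (f' \<cdot>\<^sub>m E)"
      using less.prems(3,4) mult_smult_distrib[OF A W', of ?t] mult_smult_distrib[OF C W', of ?t] by simp_all
    hence "A * W' = f' \<cdot>\<^sub>m B" "C * W' = f' \<cdot>\<^sub>m E"
      by (auto dest: smult_mat_cancel)
    thus ?thesis using less.hyps[OF deg W' f'0] by blast
  qed
qed

text \<open>If \<open>C A\<^sup>-\<^sup>1 B\<close> were polynomial, minimality would make first \<open>A\<^sup>-\<^sup>1 B\<close> and then \<open>A\<^sup>-\<^sup>1\<close>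
  regular at \<open>x\<close>.\<close>

lemma transfer_function_neq_0_if_pole:
  fixes A :: "'a::field poly mat"
  assumes n: "0 < n"
    and A: "A \<in> carrier_mat n n" and B: "B \<in> carrier_mat n r"
    and C: "C \<in> carrier_mat q n" and D: "D \<in> carrier_mat q r"
    and d: "det A \<noteq> 0" and root: "poly (det A) x = 0"
    and min: "minimal_at (PSM A B C D) x"
  shows "transfer_function (PSM A B C D) \<noteq> 0\<^sub>m q r"
proof
  assume zero: "transfer_function (PSM A B C D) = 0\<^sub>m q r"
  let ?d = "det A" and ?A = "eval_mat A x" and ?B = "eval_mat B x" and ?C = "eval_mat C x"
  note adj = adj_mat[OF A]
  define W where "W = adj_mat A * B"
  have W: "W \<in> carrier_mat n r" using adj(1) B by (simp add: W_def)
  have Ax: "?A \<in> carrier_mat n n" and Bx: "?B \<in> carrier_mat n r" and Cx: "?C \<in> carrier_mat q n"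
    using A B C by simp_all
  have rk: "mat_rank (?A @\<^sub>r ?C) = n" "mat_rank (append_cols_mat ?A ?B) = n"
    using min n A unfolding minimal_at_def by auto
  have AW: "A * W = ?d \<cdot>\<^sub>m B"
    unfolding W_def assoc_mult_mat[OF A adj(1) B, symmetric] adj(2)
    using mult_smult_assoc_mat[OF one_carrier_mat B] B by simp
  \<comment> \<open>This is the vanishing of the transfer function with denominators cleared; thus
    \<open>C\<close> times \<open>W\<close> is divisible by the determinant.\<close>
  have "C * W = ?d \<cdot>\<^sub>m - D"
  proof (rule eq_matI)
    fix i j assume "i < dim_row (?d \<cdot>\<^sub>m - D)" "j < dim_col (?d \<cdot>\<^sub>m - D)"
    hence ij: "i < q" "j < r" using D by auto
    have CW: "C * adj_mat A * B = C * W" unfolding W_def using assoc_mult_mat[OF C adj(1) B] .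
    have "transfer_function (PSM A B C D) $$ (i, j) = 0" unfolding zero using ij by simp
    hence "to_fract (D $$ (i, j)) + inverse (to_fract ?d) * to_fract ((C * W) $$ (i, j)) = 0"
      unfolding transfer_function_adj[OF A B C d] CW using ij C D W by simp
    hence "to_fract (?d * D $$ (i, j) + (C * W) $$ (i, j)) = 0"
      using d by (simp add: field_simps)
    hence "?d * D $$ (i, j) + (C * W) $$ (i, j) = 0" by (simp only: to_fract_eq_0_iff)
    thus "(C * W) $$ (i, j) = (?d \<cdot>\<^sub>m - D) $$ (i, j)"
      using ij D by (simp add: eq_neg_iff_add_eq_0 add.commute)
  qed (use C W D in auto)
  moreover have "- D \<in> carrier_mat q r" using D by simp
  ultimately obtain h W' where h: "poly h x \<noteq> 0" and W': "W' \<in> carrier_mat n r"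
    and AW': "A * W' = h \<cdot>\<^sub>m B"
    using divide_out_root[OF A C B _ mat_rank_append_rows_eqD[OF Ax Cx rk(1)] W d AW] by blast
  obtain U V where U: "U \<in> carrier_mat n n" and V: "V \<in> carrier_mat r n"
    and UV: "?A * U + ?B * V = 1\<^sub>m n"
    using mat_rank_append_cols_eqD[OF Ax Bx rk(2)] .
  let ?h = "poly h x" and ?W = "eval_mat W' x"
  have Wx: "?W \<in> carrier_mat n r" using W' by simp
  have "?A * ?W = eval_mat (h \<cdot>\<^sub>m B) x"
    unfolding AW'[symmetric] eval_mat_mult[OF A W'] ..
  also have "\<dots> = ?h \<cdot>\<^sub>m ?B" by (intro eq_matI) auto
  finally have AWx: "?A * ?W = ?h \<cdot>\<^sub>m ?B" .
  have hU: "?h \<cdot>\<^sub>m U \<in> carrier_mat n n" and WV: "?W * V \<in> carrier_mat n n"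
    using U V Wx by simp_all
  \<comment> \<open>Since \<open>?h\<close> times \<open>?B\<close> is a multiple of
    \<open>?A\<close>, the Bezout identity times the nonzero scalar \<open>?h\<close> factors
    through \<open>?A\<close>, which would make \<open>?A\<close> invertible.\<close>
  have "?A * (?h \<cdot>\<^sub>m U + ?W * V) = ?h \<cdot>\<^sub>m (?A * U) + ?h \<cdot>\<^sub>m (?B * V)"
    unfolding mult_add_distrib_mat[OF Ax hU WV] mult_smult_distrib[OF Ax U]
      assoc_mult_mat[OF Ax Wx V, symmetric] AWx mult_smult_assoc_mat[OF Bx V] ..
  also have "\<dots> = ?h \<cdot>\<^sub>m (?A * U + ?B * V)"
    using Ax U Bx V by (intro add_smult_distrib_left_mat[symmetric]) auto
  finally have "?A * (?h \<cdot>\<^sub>m U + ?W * V) = ?h \<cdot>\<^sub>m 1\<^sub>m n" unfolding UV .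
  hence "det ?A * det (?h \<cdot>\<^sub>m U + ?W * V) = ?h ^ n"
    using det_mult[OF Ax add_carrier_mat[OF WV], of "?h \<cdot>\<^sub>m U"] by (simp add: det_smult)
  moreover have "det ?A = 0"
    using comm_ring_hom.hom_det[OF comm_ring_hom_poly, of x A] root by simp
  ultimately show False using h by simp
qed

section \<open>The reversed system matrix at 0\<close>

lemma eval_mat_poly_rev_pencil:
  assumes "M1 \<in> carrier_mat k m" "M0 \<in> carrier_mat k m"
  shows "eval_mat (map_mat (poly_rev 1) (pencil M1 M0)) 0 = M1"
proof (rule eq_matI)
  fix i j assume "i < dim_row M1" "j < dim_col M1"
  hence ij: "i < k" "j < m" using assms by auto
  have "poly (poly_rev 1 [:a, b:]) 0 = b" for a b :: 'a
    by (simp add: poly_rev_def poly_monom atMost_Suc)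
  thus "eval_mat (map_mat (poly_rev 1) (pencil M1 M0)) 0 $$ (i, j) = M1 $$ (i, j)"
    using ij carrier_matD[OF pencil_carrier[OF assms(2), of M1]] index_pencil[OF assms ij] by simp
qed (use assms carrier_matD[OF pencil_carrier[OF assms(2), of M1]] in auto)

text \<open>The state block alone forces degree 1, so the reversal of the system matrix has grade 1
  whatever the other blocks are.\<close>

lemma psm_degree_pencil:
  assumes n: "0 < n"
    and A1: "A1 \<in> carrier_mat n n" and A0: "A0 \<in> carrier_mat n n"
    and B1: "B1 \<in> carrier_mat n r" and B0: "B0 \<in> carrier_mat n r"
    and C1: "C1 \<in> carrier_mat q n" and C0: "C0 \<in> carrier_mat q n"
    and D1: "D1 \<in> carrier_mat q r" and D0: "D0 \<in> carrier_mat q r"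
    and A1_neq: "A1 \<noteq> 0\<^sub>m n n"
  shows "psm_degree (PSM (pencil A1 A0) (pencil B1 B0) (pencil C1 C0) (pencil D1 D0)) = 1"
proof (rule antisym)
  let ?L = "PSM (pencil A1 A0) (pencil B1 B0) (pencil C1 C0) (pencil D1 D0)"
  note dims = carrier_matD[OF pencil_carrier[OF A0, of A1]] carrier_matD[OF pencil_carrier[OF B0, of B1]]
    carrier_matD[OF pencil_carrier[OF C0, of C1]] carrier_matD[OF pencil_carrier[OF D0, of D1]]
  show "psm_degree ?L \<le> 1"
    unfolding mat_degree_le_iff psm_mat_def
    by (auto simp: dims index_pencil[OF A1 A0] index_pencil[OF B1 B0] index_pencil[OF C1 C0]
        index_pencil[OF D1 D0])
  obtain i j where ij: "i < n" "j < n" "A1 $$ (i, j) \<noteq> 0"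
    using A1_neq A1 by (metis eq_matI carrier_matD index_zero_mat)
  have "degree (psm_mat ?L $$ (i, j)) = 1"
    using ij by (simp add: psm_mat_def dims index_pencil[OF A1 A0])
  thus "1 \<le> psm_degree ?L"
    using degree_le_mat_degree[of i "psm_mat ?L" j] ij by (simp add: psm_mat_def dims)
qed

text \<open>At 0 the reversed state matrix equals the invertible \<open>A1\<close>, which alone
  gives both rank conditions.\<close>

lemma minimal_at_psm_rev_pencil:
  assumes n: "0 < n"
    and A1: "A1 \<in> carrier_mat n n" and A0: "A0 \<in> carrier_mat n n"
    and B1: "B1 \<in> carrier_mat n r" and B0: "B0 \<in> carrier_mat n r"
    and C1: "C1 \<in> carrier_mat q n" and C0: "C0 \<in> carrier_mat q n"
    and D1: "D1 \<in> carrier_mat q r" and D0: "D0 \<in> carrier_mat q r"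
    and A': "A' \<in> carrier_mat n n" "A1 * A' = 1\<^sub>m n" "A' * A1 = 1\<^sub>m n"
  shows "minimal_at (psm_rev (PSM (pencil A1 A0) (pencil B1 B0) (pencil C1 C0) (pencil D1 D0))) 0"
proof -
  have "A1 \<noteq> 0\<^sub>m n n"
  proof
    assume "A1 = 0\<^sub>m n n"
    hence "1\<^sub>m n = (0\<^sub>m n n :: 'a mat)" using A'(1,2) by simp
    hence "1\<^sub>m n $$ (0, 0) = (0\<^sub>m n n :: 'a mat) $$ (0, 0)" by simp
    thus False using n by simp
  qed
  hence deg: "psm_degree (PSM (pencil A1 A0) (pencil B1 B0) (pencil C1 C0) (pencil D1 D0)) = 1"
    using psm_degree_pencil[OF n A1 A0 B1 B0 C1 C0 D1 D0] by simp
  show ?thesis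
    unfolding minimal_at_def psm_rev_def deg Let_def
    using mat_rank_append_rows_invertible[OF A1 C1 A'(1,3)]
      mat_rank_append_cols_invertible[OF A1 B1 A'(1,2)] pencil_carrier[OF A0, of A1]
    by (simp only: partitioned_mat.sel eval_mat_poly_rev_pencil[OF A1 A0]
        eval_mat_poly_rev_pencil[OF B1 B0] eval_mat_poly_rev_pencil[OF C1 C0]) simp
qed

section \<open>Powers of the variable and reversals\<close>

lemma smult_smult_mat: "a \<cdot>\<^sub>m (b \<cdot>\<^sub>m M) = (a * b :: 'a::semigroup_mult) \<cdot>\<^sub>m M"
  by (intro eq_matI) (simp_all add: mult.assoc)

text \<open>The order of vanishing at 0 of the numerator is unaffected by denominators that are
  nonzero there.\<close>

lemma power_dvd_if_not_has_pole:
  fixes a b :: "'a::field poly"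
  assumes "poly b 0 \<noteq> 0" "\<not> has_pole (Fract a b / rat_var ^ k) 0"
  shows "[:0, 1:] ^ k dvd a"
proof -
  obtain c d where cd: "Fract a b / rat_var ^ k = Fract c d" "poly d 0 \<noteq> 0" "d \<noteq> 0"
    using assms(2) by (rule not_has_poleE)
  have b: "b \<noteq> 0" using assms(1) by auto
  have "Fract a b = Fract c d * rat_var ^ k" using cd(1) by (simp add: field_simps)
  also have "\<dots> = Fract (c * [:0, 1:] ^ k) d"
  proof -
    have "rat_var ^ k = Fract ([:0, 1 :: 'a:] ^ k) 1"
      unfolding rat_var_def to_fract_power[symmetric] by (simp add: to_fract_def)
    thus ?thesis using cd(3) by simp
  qed
  finally have eq: "a * d = c * [:0, 1:] ^ k * b" using b cd(3) by (simp add: eq_fract)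
  show ?thesis
  proof (cases "a = 0")
    case False
    have "[:- 0, 1:] ^ k dvd a * d" unfolding eq by simp
    hence "k \<le> order 0 (a * d)" 
      using False cd(3) order_divides[of 0 k "a * d"] by simp
    also have "\<dots> = order 0 a" using False cd(2,3) by (simp add: order_mult order_0I)
    finally show ?thesis using order_divides[of 0 k a] by simp
  qed simp
qed

lemma not_has_pole_rat_var_powi_iff:
  "\<not> has_pole (rat_var powi j) (0 :: 'a::field) \<longleftrightarrow> 0 \<le> j"
proof
  assume "0 \<le> j"
  hence "rat_var powi j = to_fract ([:0, 1 :: 'a:] ^ nat j)"
    by (simp add: power_int_def rat_var_def to_fract_power)
  thus "\<not> has_pole (rat_var powi j) (0 :: 'a)" by simp
next
  assume np: "\<not> has_pole (rat_var powi j) (0 :: 'a)"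
  show "0 \<le> j"
  proof (rule ccontr)
    assume "\<not> 0 \<le> j"
    hence "rat_var powi j = Fract 1 (1 :: 'a poly) / rat_var ^ nat (- j)"
      by (simp add: power_int_def field_simps fract_collapse)
    hence "[:0, 1:] ^ nat (- j) dvd (1 :: 'a poly)"
      using np power_dvd_if_not_has_pole[of 1 1 "nat (- j)"] by simp
    hence "degree ([:0, 1:] ^ nat (- j) :: 'a poly) = 0"
      unfolding is_unit_iff_degree[OF one_neq_zero] by (auto dest: dvd_imp_degree_le)
    thus False using \<open>\<not> 0 \<le> j\<close> by (simp add: degree_power_eq)
  qed
qed

lemma not_has_pole_all_imp_0:
  assumes "\<And>k. \<not> has_pole (f / rat_var ^ k) 0"
  shows "f = 0"
proof (rule ccontr)
  assume "f \<noteq> 0"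
  obtain a b where f: "f = Fract a b" "poly b 0 \<noteq> 0" "b \<noteq> 0"
    using assms[of 0] by (auto elim: not_has_poleE)
  have a: "a \<noteq> 0" using \<open>f \<noteq> 0\<close> f by (auto simp: fract_collapse)
  \<comment> \<open>The exponent is the first one that exceeds the degree of the nonzero
    numerator.\<close>
  have "[:0, 1:] ^ Suc (degree a) dvd a"
    by (rule power_dvd_if_not_has_pole[OF f(2)]) (use assms f in blast)
  hence "degree ([:0, 1:] ^ Suc (degree a) :: 'a poly) \<le> degree a"
    using a by (rule dvd_imp_degree_le)
  thus False by (simp add: degree_power_eq del: power_Suc)
qed

section \<open>Change of grade and properness\<close>

lemma rat_rev_add: "rat_rev (g + h) f = rat_var powi h * rat_rev g f"
  by (simp add: rat_rev_def power_int_add)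

lemma rev_grade_add: "rev_grade (g + h) G = rat_var powi h \<cdot>\<^sub>m rev_grade g G"
  by (intro eq_matI) (simp_all add: rat_rev_add)

lemma rat_rev_neq_0:
  assumes "f \<noteq> 0"
  shows "rat_rev g f \<noteq> 0"
proof -
  obtain a b where f: "f = Fract a b" "b \<noteq> 0" by (cases f) auto
  have "a \<noteq> 0" using assms f by (auto simp: fract_collapse)
  thus ?thesis using f by (simp add: rat_rev_def rat_recip_Fract poly_at_recip)
qed

text \<open>A proper function is finite at infinity: scaling by the power \<open>degree b\<close>
  makes both parts polynomials, and the constant term of the new denominator is the leading
  coefficient of \<open>b\<close>.\<close>

lemma not_has_pole_rat_rev_0:
  assumes "b \<noteq> 0" "degree a \<le> degree b"
  shows "\<not> has_pole (rat_rev 0 (Fract a b)) 0"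
proof -
  let ?E = "\<lambda>p. poly_at_rat p (1 / rat_var)" and ?l = "rat_var ^ degree b"
  have "rat_rev 0 (Fract a b) = (?l * ?E a) / (?l * ?E b)"
    by (simp add: rat_rev_def rat_recip_Fract assms(1))
  also have "\<dots> = to_fract (poly_rev (degree b) a) / to_fract (reflect_poly b)"
    by (simp only: rat_var_power_poly_at_recip[OF assms(2)] rat_var_power_poly_at_recip[OF order_refl]
        poly_rev_degree)
  also have "\<dots> = Fract (poly_rev (degree b) a) (reflect_poly b)"
    by (simp add: to_fract_def)
  finally show ?thesis using not_has_pole_Fract[of "reflect_poly b" 0] assms(1) by simp
qed

section \<open>Equivalence of padded matrices and of their multiples by the variable\<close>

text \<open>The first diagonal entry of the scaled identity block is \<open>c\<close>
  itself.\<close>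

lemma not_has_pole_if_pole_free_smult_pad:
  assumes "pole_free (c \<cdot>\<^sub>m pad s X) x" "0 < s"
  shows "\<not> has_pole c x"
proof -
  have "\<not> has_pole ((c \<cdot>\<^sub>m pad s X) $$ (dim_row X, dim_col X)) x"
    using assms unfolding pole_free_def by simp
  thus ?thesis using assms(2) by (simp add: index_pad)
qed

text \<open>A power of the variable that can be divided out of \<open>Y\<close> can be divided out
  once more from \<open>rat_var\<close> times \<open>Y\<close>, hence by equivalence also from
  \<open>Y\<close>. So every power divides the entries.\<close>

lemma equivalent_at_smult_rat_var_imp_0:
  assumes pf: "pole_free Y 0" and eqv: "equivalent_at 0 Y (rat_var \<cdot>\<^sub>m Y)"
  shows "Y = 0\<^sub>m (dim_row Y) (dim_col Y)"
proof -
  have "pole_free (inverse rat_var ^ k \<cdot>\<^sub>m Y) 0" for k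
  proof (induction k)
    case (Suc k)
    have "inverse rat_var ^ k \<cdot>\<^sub>m Y = inverse rat_var ^ Suc k \<cdot>\<^sub>m (rat_var \<cdot>\<^sub>m Y)"
      by (simp add: smult_smult_mat field_simps)
    thus ?case using Suc.IH equivalent_at_pole_free_smult_iff[OF eqv, of "inverse rat_var ^ Suc k"]
      by simp
  next
    case 0
    have "1 \<cdot>\<^sub>m Y = Y" by (intro eq_matI) simp_all
    thus ?case using pf by simp
  qed
  hence "\<not> has_pole (Y $$ (i, j) / rat_var ^ k) 0" if "i < dim_row Y" "j < dim_col Y" for i j k
    using that unfolding pole_free_def by (auto simp: divide_inverse power_inverse mult.commute)
  hence "Y $$ (i, j) = 0" if "i < dim_row Y" "j < dim_col Y" for i j
    using not_has_pole_all_imp_0 that by blast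
  thus ?thesis by (intro eq_matI) simp_all
qed

text \<open>Cancellation leaves a surplus identity block of size \<open>d\<close> on one side. Its
  entry 1 bounds the powers of the variable that can be divided out, and the two equivalences then
  contradict each other.\<close>

lemma padded_equivalences_incompatible:
  assumes pf: "pole_free Y 0" and Y: "Y \<noteq> 0\<^sub>m (dim_row Y) (dim_col Y)"
    and e: "equivalent_at 0 (pad s1 X) (pad s2 Y)"
    and e': "equivalent_at 0 (pad t1 (rat_var powi k \<cdot>\<^sub>m X)) (pad t2 (rat_var \<cdot>\<^sub>m Y))"
    and pad: "int t1 - int t2 = int s1 - int s2" "s1 \<noteq> s2"
  shows False
proof -
  have var: "\<not> has_pole rat_var (0 :: 'a)"
    using not_has_pole_rat_var_powi_iff[of 1] by simp
  have pf': "pole_free (rat_var \<cdot>\<^sub>m Y) 0" using var pf by (rule pole_free_smult)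
  have one: "1 \<cdot>\<^sub>m M = M" for M :: "'a poly fract mat" by (intro eq_matI) simp_all
  show False
  proof (cases "s2 < s1")
    case True
    define d where "d = s1 - s2"
    have d: "0 < d" "t1 = d + t2" using True pad by (auto simp: d_def)
    have "equivalent_at 0 (pad t2 (rat_var \<cdot>\<^sub>m Y)) (pad t2 (pad d (rat_var powi k \<cdot>\<^sub>m X)))"
      using equivalent_at_sym[OF e'] d by (simp add: pad_pad)
    hence "equivalent_at 0 (rat_var \<cdot>\<^sub>m Y) (pad d (rat_var powi k \<cdot>\<^sub>m X))"
      by (rule equivalent_at_cancel[OF pf'])
    moreover have "pole_free (inverse rat_var \<cdot>\<^sub>m (rat_var \<cdot>\<^sub>m Y)) 0"
      using pf by (simp add: smult_smult_mat one)
    ultimately have "\<not> has_pole (inverse rat_var) (0 :: 'a)"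
      using equivalent_at_pole_free_smult_iff not_has_pole_if_pole_free_smult_pad d(1) by blast
    hence "\<not> has_pole (rat_var powi - 1) (0 :: 'a)" by (simp add: power_int_minus)
    thus False unfolding not_has_pole_rat_var_powi_iff by simp
  next
    case False
    define d where "d = s2 - s1"
    have d: "0 < d" "s2 = d + s1" "t2 = d + t1" using False pad by (auto simp: d_def)
    have pfd: "pole_free (pad d Y) 0" and pfd': "pole_free (pad d (rat_var \<cdot>\<^sub>m Y)) 0"
      using pf pf' by (simp_all add: pole_free_pad_iff)
    have "equivalent_at 0 (pad s1 (pad d Y)) (pad s1 X)"
      using equivalent_at_sym[OF e] d by (simp add: pad_pad)
    hence YX: "equivalent_at 0 (pad d Y) X" by (rule equivalent_at_cancel[OF pfd])
    have "equivalent_at 0 (pad t1 (pad d (rat_var \<cdot>\<^sub>m Y))) (pad t1 (rat_var powi k \<cdot>\<^sub>m X))"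
      using equivalent_at_sym[OF e'] d by (simp add: pad_pad)
    hence YX': "equivalent_at 0 (pad d (rat_var \<cdot>\<^sub>m Y)) (rat_var powi k \<cdot>\<^sub>m X)"
      by (rule equivalent_at_cancel[OF pfd'])
    \<comment> \<open>Transported along the first equivalence, this multiplies the identity block of
      \<open>pad d Y\<close> by the power \<open>k\<close>, whence \<open>k\<close> is
      nonnegative.\<close>
    have "pole_free (rat_var powi k \<cdot>\<^sub>m X) 0" by (rule equivalent_at_pole_free[OF YX' pfd'])
    hence "pole_free (rat_var powi k \<cdot>\<^sub>m pad d Y) 0"
      using equivalent_at_pole_free_smult_iff[OF YX] by blast
    hence "\<not> has_pole (rat_var powi k) (0 :: 'a)"
      using not_has_pole_if_pole_free_smult_pad d(1) by blast
    hence k1: "0 \<le> k" by (simp add: not_has_pole_rat_var_powi_iff)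
    \<comment> \<open>The same test in the other direction: \<open>X\<close> has no pole, and the
      second equivalence shows that \<open>- k\<close> is nonnegative too.\<close>
    have "rat_var powi (- k) \<cdot>\<^sub>m (rat_var powi k \<cdot>\<^sub>m X) = X"
      by (simp add: smult_smult_mat one power_int_minus)
    hence "pole_free (rat_var powi (- k) \<cdot>\<^sub>m (rat_var powi k \<cdot>\<^sub>m X)) 0"
      using equivalent_at_pole_free[OF YX pfd] by simp
    hence "pole_free (rat_var powi (- k) \<cdot>\<^sub>m pad d (rat_var \<cdot>\<^sub>m Y)) 0"
      using equivalent_at_pole_free_smult_iff[OF YX'] by blast
    hence "\<not> has_pole (rat_var powi (- k)) (0 :: 'a)"
      using not_has_pole_if_pole_free_smult_pad d(1) by blast
    hence "k = 0" using k1 by (simp add: not_has_pole_rat_var_powi_iff)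
    hence "equivalent_at 0 (pad d (rat_var \<cdot>\<^sub>m Y)) X" using YX' by (simp add: one)
    hence "equivalent_at 0 (pad d Y) (pad d (rat_var \<cdot>\<^sub>m Y))"
      using equivalent_at_trans[OF YX equivalent_at_sym] by blast
    hence "equivalent_at 0 Y (rat_var \<cdot>\<^sub>m Y)" by (rule equivalent_at_cancel[OF pf])
    thus False using equivalent_at_smult_rat_var_imp_0[OF pf] Y by blast
  qed
qed

text \<open>Both padded matrices have the same size; this yields the relation that
  \<open>ADMZ_strong_linearization\<close> leaves implicit.\<close>

lemma padded_equivalent_at_compatible_padding:
  assumes "padded_equivalent_at x s1 s2 (rev_grade g G) (rev_grade h H)"
  shows "compatible_padding s1 s2 G H"
  using equivalent_at_dim[OF assms[unfolded padded_equivalent_at_iff]]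
  by (simp add: compatible_padding_def)

section \<open>The grades of a linear system matrix and of its transfer function\<close>

lemma transfer_function_no_states:
  fixes D1 D0 :: "'a::field mat"
  assumes B0: "B0 \<in> carrier_mat 0 r" and C0: "C0 \<in> carrier_mat q 0"
    and D1: "D1 \<in> carrier_mat q r" and D0: "D0 \<in> carrier_mat q r"
  shows "transfer_function (PSM A (pencil B1 B0) (pencil C1 C0) (pencil D1 D0)) =
    map_mat to_fract (pencil D1 D0)"
  using carrier_matD[OF pencil_carrier[OF B0, of B1]] carrier_matD[OF pencil_carrier[OF C0, of C1]]
    carrier_matD[OF pencil_carrier[OF D0, of D1]]
  unfolding transfer_function_def by (intro eq_matI) (simp_all add: scalar_prod_def)

text \<open>Without states, the system matrix and the transfer function are the same polynomial
  matrix.\<close>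

lemma natural_grade_transfer_function_no_states:
  fixes A1 A0 B1 B0 C1 C0 D1 D0 :: "'a::field mat"
  assumes A0: "A0 \<in> carrier_mat 0 0" and B0: "B0 \<in> carrier_mat 0 r" and C0: "C0 \<in> carrier_mat q 0"
    and D1: "D1 \<in> carrier_mat q r" and D0: "D0 \<in> carrier_mat q r"
  defines "L \<equiv> PSM (pencil A1 A0) (pencil B1 B0) (pencil C1 C0) (pencil D1 D0)"
  shows "natural_grade (transfer_function L) = psm_degree L"
proof -
  note dims = carrier_matD[OF pencil_carrier[OF A0, of A1]] carrier_matD[OF pencil_carrier[OF B0, of B1]]
    carrier_matD[OF pencil_carrier[OF C0, of C1]] carrier_matD[OF pencil_carrier[OF D0, of D1]]
  have t: "transfer_function L = map_mat to_fract (pencil D1 D0)"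
    unfolding L_def by (rule transfer_function_no_states[OF B0 C0 D1 D0])
  have "natural_grade (transfer_function L) = mat_degree (pencil D1 D0)"
    unfolding t
    by (rule natural_grade_eq_mat_degree[where S = "0\<^sub>m q r"])
      (auto simp: dims strictly_proper_mat_def intro!: eq_matI carrier_matI)
  also have "pencil D1 D0 = psm_mat L"
    unfolding L_def psm_mat_def by (intro eq_matI) (simp_all add: dims)
  finally show ?thesis .
qed

text \<open>The polynomial part is a pencil with leading coefficient
  \<open>D1 + C1 * A' * B1\<close>. If this vanishes, the transfer function is proper, so its
  reversal of grade 0 is finite at 0.\<close>

lemma natural_grade_transfer_function_pencil:
  fixes A1 A0 B1 B0 C1 C0 D1 D0 A' :: "'a::field mat"
  assumes n: "0 < n"
    and A1: "A1 \<in> carrier_mat n n" and A0: "A0 \<in> carrier_mat n n"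
    and B1: "B1 \<in> carrier_mat n r" and B0: "B0 \<in> carrier_mat n r"
    and C1: "C1 \<in> carrier_mat q n" and C0: "C0 \<in> carrier_mat q n"
    and D1: "D1 \<in> carrier_mat q r" and D0: "D0 \<in> carrier_mat q r"
    and A': "A' \<in> carrier_mat n n" "A1 * A' = 1\<^sub>m n" "A' * A1 = 1\<^sub>m n"
  defines "H \<equiv> transfer_function (PSM (pencil A1 A0) (pencil B1 B0) (pencil C1 C0) (pencil D1 D0))"
  shows "natural_grade H = (if D1 + C1 * A' * B1 = 0\<^sub>m q r then 0 else 1)"
    and "D1 + C1 * A' * B1 = 0\<^sub>m q r \<Longrightarrow> pole_free (rev_grade 0 H) 0"
proof -
  let ?M = "D1 + C1 * A' * B1" and ?d = "det (pencil A1 A0)"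
  obtain N W where N: "N \<in> carrier_mat q r" and W: "W \<in> carrier_mat q r"
    and deg: "\<And>i j. i < q \<Longrightarrow> j < r \<Longrightarrow> degree (W $$ (i, j)) < degree ?d"
    and H: "H = map_mat to_fract (pencil ?M N) + inverse (to_fract ?d) \<cdot>\<^sub>m map_mat to_fract W"
    using transfer_function_pencil[OF n A1 A0 B1 B0 C1 C0 D1 D0 A'] unfolding H_def by blast
  have M: "?M \<in> carrier_mat q r" using D1 C1 A' B1 by simp
  have d0: "?d \<noteq> 0" by (rule degree_det_pencil(2)[OF A1 A0 A'(1,2)])
  note dimP = carrier_matD[OF pencil_carrier[OF N, of ?M]]
  have dimH: "dim_row H = q" "dim_col H = r" unfolding H using W by simp_all
  have frac: "inverse (to_fract ?d) * to_fract w = Fract w ?d" for w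
    using d0 by (simp add: to_fract_def)
  have "strictly_proper_mat (inverse (to_fract ?d) \<cdot>\<^sub>m map_mat to_fract W)"
    unfolding strictly_proper_mat_def
  proof (intro allI impI)
    fix i j assume "i < dim_row (inverse (to_fract ?d) \<cdot>\<^sub>m map_mat to_fract W)"
      "j < dim_col (inverse (to_fract ?d) \<cdot>\<^sub>m map_mat to_fract W)"
    hence ij: "i < q" "j < r" using W by simp_all
    have "strictly_proper (Fract (W $$ (i, j)) ?d)"
      unfolding strictly_proper_def using d0 deg[OF ij] by blast
    thus "strictly_proper ((inverse (to_fract ?d) \<cdot>\<^sub>m map_mat to_fract W) $$ (i, j))"
      using ij W by (simp add: frac)
  qed
  hence "natural_grade H = mat_degree (pencil ?M N)"
    by (intro natural_grade_eq_mat_degree[OF _ _ _ H]) (use dimH dimP W in \<open>auto intro: carrier_matI\<close>)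
  thus "natural_grade H = (if ?M = 0\<^sub>m q r then 0 else 1)"
    unfolding mat_degree_pencil[OF M N] .
  assume M0: "?M = 0\<^sub>m q r"
  show "pole_free (rev_grade 0 H) 0"
    unfolding pole_free_def
  proof (intro allI impI)
    fix i j assume "i < dim_row (rev_grade 0 H)" "j < dim_col (rev_grade 0 H)"
    hence ij: "i < q" "j < r" using dimH by simp_all
    have "H $$ (i, j) = to_fract [:N $$ (i, j):] + Fract (W $$ (i, j)) ?d"
      unfolding H using ij W dimP index_pencil[OF M N ij] M0 by (simp add: frac)
    also have "\<dots> = Fract ([:N $$ (i, j):] * ?d + W $$ (i, j)) ?d"
      using d0 by (simp add: to_fract_def)
    finally have "H $$ (i, j) = Fract ([:N $$ (i, j):] * ?d + W $$ (i, j)) ?d" .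
    moreover have "degree ([:N $$ (i, j):] * ?d + W $$ (i, j)) \<le> degree ?d"
      using degree_mult_le[of "[:N $$ (i, j):]" ?d] deg[OF ij] by (intro degree_add_le) simp_all
    ultimately have "\<not> has_pole (rat_rev 0 (H $$ (i, j))) 0"
      using not_has_pole_rat_rev_0[OF d0] by simp
    thus "\<not> has_pole (rev_grade 0 H $$ (i, j)) 0" using ij dimH by simp
  qed
qed

section \<open>Comparison of the two notions of strong linearization\<close>

theorem proposition4p23:
  fixes G :: "'a::alg_closed_field poly fract mat"
    and A1 A0 B1 B0 C1 C0 D1 D0 :: "'a mat"
    and n p m q r :: nat
    and L :: "'a psm"
  assumes "G \<in> carrier_mat p m"
    and "A1 \<in> carrier_mat n n" "A0 \<in> carrier_mat n n"
    and "B1 \<in> carrier_mat n r" "B0 \<in> carrier_mat n r"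
    and "C1 \<in> carrier_mat q n" "C0 \<in> carrier_mat q n"
    and "D1 \<in> carrier_mat q r" "D0 \<in> carrier_mat q r"
    and "L = PSM (pencil A1 A0) (pencil B1 B0) (pencil C1 C0) (pencil D1 D0)"
    and "ADMZ_strong_linearization L G"
  shows "(n = 0 \<or> n > 0 \<and> D1 + C1 * the (mat_inverse A1) * B1 \<noteq> 0\<^sub>m q r \<longrightarrow>
            strong_linearization (int (natural_grade G)) L G) \<and>
         (n > 0 \<and> D1 + C1 * the (mat_inverse A1) * B1 = 0\<^sub>m q r \<and> q = p \<and> r = m \<longrightarrow>
            strong_linearization (int (natural_grade G) + 1) L G) \<and>
         (n > 0 \<and> D1 + C1 * the (mat_inverse A1) * B1 = 0\<^sub>m q r \<and> (q \<noteq> p \<or> r \<noteq> m) \<longrightarrow>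
            (\<forall>g::int. \<not> strong_linearization g L G))"
proof -
  note A1 = assms(2) and A0 = assms(3) and B1 = assms(4) and B0 = assms(5) and C1 = assms(6)
    and C0 = assms(7) and D1 = assms(8) and D0 = assms(9) and L = assms(10)
  note dims = carrier_matD[OF pencil_carrier[OF A0, of A1]] carrier_matD[OF pencil_carrier[OF D0, of D1]]
    carrier_matD[OF pencil_carrier[OF B0, of B1]] carrier_matD[OF pencil_carrier[OF C0, of C1]]
  define H where "H = transfer_function L"
  define M where "M = D1 + C1 * the (mat_inverse A1) * B1"
  have dimH: "dim_row H = q" "dim_col H = r"
    unfolding H_def L transfer_function_def by (simp_all add: dims)
  have fin: "finite_linearization L G"
    using assms(11) by (simp add: ADMZ_strong_linearization_def)
  have lin: "linear_psm L" and min: "minimal_at L x" for x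
    using fin by (simp_all add: finite_linearization_def linearization_at_def)
  obtain s1 s2 where pe: "padded_equivalent_at 0 s1 s2 (rev_grade (int (natural_grade G)) G)
      (rev_grade (int (natural_grade H)) H)"
    using assms(11) unfolding ADMZ_strong_linearization_def rat_mat_rev_def H_def by blast
  have comp: "compatible_padding s1 s2 G H"
    by (rule padded_equivalent_at_compatible_padding[OF pe])
  show ?thesis
  proof (cases "n = 0")
    case True
    have "natural_grade H = psm_degree L"
      unfolding H_def L using natural_grade_transfer_function_no_states A0 B0 C0 D1 D0 True by blast
    moreover have "minimal_at (psm_rev L) 0"
      by (simp add: minimal_at_def psm_rev_def Let_def L dims True)
    ultimately have "linearization_at_infinity (int (natural_grade G)) L G"
      unfolding linearization_at_infinity_def using lin comp pe H_def by auto
    thus ?thesis using True fin by (simp add: strong_linearization_def)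
  next
    case False
    hence n: "0 < n" by simp
    have "map_mat (\<lambda>p. coeff p 1) (psm_A L) = A1"
      using A1 by (intro eq_matI) (auto simp: L dims index_pencil[OF A1 A0])
    hence "invertible_mat A1"
      using assms(11) n unfolding ADMZ_strong_linearization_def by (simp add: L dims)
    then obtain A' where "A1 * A' = 1\<^sub>m (dim_row A1)" "A' * A1 = 1\<^sub>m (dim_row A')"
      unfolding invertible_mat_def inverts_mat_def by blast
    moreover from this have "A' \<in> carrier_mat n n"
      using A1 by (metis carrier_matD carrier_matI index_mult_mat(2,3) index_one_mat(2,3))
    ultimately have A': "A' \<in> carrier_mat n n" "A1 * A' = 1\<^sub>m n" "A' * A1 = 1\<^sub>m n"
      using A1 by auto
    have M_eq: "M = D1 + C1 * A' * B1"
      unfolding M_def the_mat_inverse_eqI[OF A1 A'(1,2)] ..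
    have grade: "natural_grade H = (if M = 0\<^sub>m q r then 0 else 1)"
      unfolding H_def L M_eq
      by (rule natural_grade_transfer_function_pencil(1)[OF n A1 A0 B1 B0 C1 C0 D1 D0 A'])
    have A1_neq: "A1 \<noteq> 0\<^sub>m n n"
    proof
      assume "A1 = 0\<^sub>m n n"
      hence "1\<^sub>m n $$ (0, 0) = (0\<^sub>m n n :: 'a mat) $$ (0, 0)" using A'(1,2) by simp
      thus False using n by simp
    qed
    have deg: "psm_degree L = 1"
      unfolding L by (rule psm_degree_pencil[OF n A1 A0 B1 B0 C1 C0 D1 D0 A1_neq])
    have min_rev: "minimal_at (psm_rev L) 0"
      unfolding L by (rule minimal_at_psm_rev_pencil[OF n A1 A0 B1 B0 C1 C0 D1 D0 A'])
    \<comment> \<open>Here the natural grade of \<open>H\<close> equals the degree of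
      \<open>L\<close>, so the given equivalence is already the one required at infinity.\<close>
    have a: "strong_linearization (int (natural_grade G)) L G" if "M \<noteq> 0\<^sub>m q r"
      unfolding strong_linearization_def linearization_at_infinity_def
      using fin lin min_rev comp pe grade deg that by (auto simp: H_def)
    have rev_H: "rev_grade 1 H = rat_var \<cdot>\<^sub>m rev_grade 0 H"
      using rev_grade_add[of 0 1 H] by simp
    have Y: "pole_free (rev_grade 0 H) 0" if "M = 0\<^sub>m q r"
      unfolding H_def L
      by (rule natural_grade_transfer_function_pencil(2)[OF n A1 A0 B1 B0 C1 C0 D1 D0 A'])
        (use that M_eq in simp)
    have eqv: "equivalent_at 0 (pad s1 (rev_grade (int (natural_grade G)) G))
        (pad s2 (rev_grade 0 H))" if "M = 0\<^sub>m q r"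
      using pe grade that by (simp add: padded_equivalent_at_iff)
    have b: "strong_linearization (int (natural_grade G) + 1) L G"
      if M0: "M = 0\<^sub>m q r" and qp: "q = p" "r = m"
    proof -
      have "s1 = s2" using comp qp dimH assms(1) by (simp add: compatible_padding_def)
      \<comment> \<open>Cancellation starts from the side of \<open>H\<close>, whose reversal is
        already known to have no pole at 0.\<close>
      hence "equivalent_at 0 (rev_grade 0 H) (rev_grade (int (natural_grade G)) G)"
        using equivalent_at_cancel[OF Y[OF M0]] equivalent_at_sym[OF eqv[OF M0]] by blast
      hence "equivalent_at 0 (rat_var \<cdot>\<^sub>m rev_grade (int (natural_grade G)) G)
          (rat_var \<cdot>\<^sub>m rev_grade 0 H)"
        by (rule equivalent_at_smult[OF equivalent_at_sym])
      hence "padded_equivalent_at 0 0 0 (rev_grade (int (natural_grade G) + 1) G) (rev_grade 1 H)"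
        unfolding padded_equivalent_at_iff pad_0 rev_H rev_grade_add[of _ 1] power_int_1_right .
      moreover have "compatible_padding 0 0 G H"
        using qp dimH assms(1) by (simp add: compatible_padding_def)
      ultimately show ?thesis
        unfolding strong_linearization_def linearization_at_infinity_def
        using fin lin min_rev deg by (auto simp: H_def)
    qed
    have c: "\<not> strong_linearization g L G"
      if M0: "M = 0\<^sub>m q r" and qp: "q \<noteq> p \<or> r \<noteq> m" for g
    proof
      assume "strong_linearization g L G"
      then obtain t1 t2 where comp': "compatible_padding t1 t2 G H"
        and pe': "padded_equivalent_at 0 t1 t2 (rev_grade g G) (rev_grade 1 H)"
        unfolding strong_linearization_def linearization_at_infinity_def deg H_def by auto
      have "rev_grade g G = rat_var powi (g - int (natural_grade G)) \<cdot>\<^sub>m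
          rev_grade (int (natural_grade G)) G"
        using rev_grade_add[of "int (natural_grade G)" "g - int (natural_grade G)" G] by simp
      hence eqv': "equivalent_at 0
          (pad t1 (rat_var powi (g - int (natural_grade G)) \<cdot>\<^sub>m rev_grade (int (natural_grade G)) G))
          (pad t2 (rat_var \<cdot>\<^sub>m rev_grade 0 H))"
        using pe' rev_H by (simp add: padded_equivalent_at_iff)
      \<comment> \<open>Row and column differences agree, so either inequality of sizes excludes
        equal paddings.\<close>
      have pads: "int t1 - int t2 = int s1 - int s2" "s1 \<noteq> s2"
        using comp comp' qp dimH assms(1) by (auto simp: compatible_padding_def)
      have "degree (det (pencil A1 A0)) = n" "det (pencil A1 A0) \<noteq> 0"
        using degree_det_pencil[OF A1 A0 A'(1,2)] .
      \<comment> \<open>The determinant has positive degree \<open>n\<close>, so algebraic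
        closedness supplies a root, at which minimality forces \<open>H\<close> to be
        nonzero.\<close>
      moreover from this obtain x where "poly (det (pencil A1 A0)) x = 0"
        using alg_closed_imp_poly_has_root n by metis
      ultimately have "H \<noteq> 0\<^sub>m q r"
        unfolding H_def L
        by (intro transfer_function_neq_0_if_pole[OF n _ _ _ _ _ _ min[of x, unfolded L]])
          (use A0 B0 C0 D0 in simp_all)
      then obtain i j where ij: "i < q" "j < r" "H $$ (i, j) \<noteq> 0"
        using dimH by (metis eq_matI index_zero_mat)
      have "rev_grade 0 H $$ (i, j) \<noteq> 0" using ij dimH rat_rev_neq_0 by simp
      hence "rev_grade 0 H \<noteq> 0\<^sub>m (dim_row (rev_grade 0 H)) (dim_col (rev_grade 0 H))"
        using ij dimH by (metis index_map_mat(2,3) index_zero_mat(1))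
      thus False by (rule padded_equivalences_incompatible[OF Y[OF M0] _ eqv[OF M0] eqv' pads])
    qed
    show ?thesis using False a b c unfolding M_def by blast
  qed
qed

end
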